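(* Let $H\in\mathbb{R}^{d\times d}$ be symmetric positive semidefinite, $\rho>0$, $H_\rho=H+\rho I$, $\delta\in(0,1)$, and let $\epsilon>0$ be a user-defined tolerance. Let $\Omega\in\mathbb{R}^{d\times s}$ have i.i.d. standard Gaussian entries, and let $P$, with associated $\hat\lambda_s$, be the randomized Nyström preconditioner built from $\Omega$. Suppose \[ s\geq 8\left(\sqrt{d_{\mathrm{eff}}\!\left(\tfrac{\epsilon\rho}{6}\right)}+\sqrt{8\log(16/\delta)}\right)^{2}. \] Then \[ \frac{\hat\lambda_s+\rho}{\rho}\leq 1+\frac{\epsilon}{42}, \] and furthermore, with probability at least $1-\delta$, \[ \left|\kappa_2\big(P^{-1/2}H_\rho P^{-1/2}\big)-\frac{\hat\lambda_s+\rho}{\rho}\right|\leq\epsilon . \]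
   Context: For symmetric psd $H$ and $\sigma>0$, $d_{\mathrm{eff}}(\sigma)=\mathrm{tr}\big(H(H+\sigma I)^{-1}\big)$. The Nyström approximation is $H\langle\Omega\rangle=(H\Omega)(\Omega^{T}H\Omega)^{\dagger}(H\Omega)^{T}=U\hat\Lambda U^{T}$ with $U\in\mathbb{R}^{d\times s}$ having orthonormal columns and $\hat\Lambda=\mathrm{diag}(\hat\lambda_1\ge\dots\ge\hat\lambda_s)$, so $\hat\lambda_s$ is its $s$-th largest eigenvalue. The randomized Nyström preconditioner is $P=\frac{1}{\hat\lambda_s+\rho}U(\hat\Lambda+\rho I)U^{T}+(I-UU^{T})$. The quantity $(\hat\lambda_s+\rho)/\rho$ is called the empirical condition number. $\kappa_2$ is the spectral condition number. *)

theory Defs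
  imports "HOL-Analysis.Analysis" "HOL-Probability.Probability"
begin

text \<open>Matrices are HOL-Analysis matrices real^'n^'m (m rows, n columns); the dimensions
 d and s are finite index types, with d = CARD('d), s = CARD('s).\<close>

definition sym_psd :: "real^'n^'n \<Rightarrow> bool" where
  "sym_psd A \<longleftrightarrow> transpose A = A \<and> (\<forall>x. 0 \<le> x \<bullet> (A *v x))"

definition sym_pd :: "real^'n^'n \<Rightarrow> bool" where
  "sym_pd A \<longleftrightarrow> transpose A = A \<and> (\<forall>x. x \<noteq> 0 \<longrightarrow> 0 < x \<bullet> (A *v x))"

definition d_eff :: "real^'n^'n \<Rightarrow> real \<Rightarrow> real" where
  "d_eff H \<sigma> = trace (H ** matrix_inv (H + \<sigma> *\<^sub>R mat 1))"

definition pinv :: "real^'n^'m \<Rightarrow> real^'m^'n" where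
  "pinv A = (THE X. A ** X ** A = A \<and> X ** A ** X = X \<and>
                   transpose (A ** X) = A ** X \<and> transpose (X ** A) = X ** A)"

definition nystrom :: "real^'d^'d \<Rightarrow> real^'s^'d \<Rightarrow> real^'d^'d" where
  "nystrom H \<Omega> = (H ** \<Omega>) ** pinv (transpose \<Omega> ** H ** \<Omega>) ** transpose (H ** \<Omega>)"

definition nystrom_eig :: "real^'d^'d \<Rightarrow> real^'s^'d \<Rightarrow> real^'s^'d \<Rightarrow> real^'s^'s \<Rightarrow> bool" where
  "nystrom_eig H \<Omega> U \<Lambda> \<longleftrightarrow> transpose U ** U = mat 1 \<and>
      (\<forall>i j. i \<noteq> j \<longrightarrow> \<Lambda> $ i $ j = 0) \<and>
      nystrom H \<Omega> = U ** \<Lambda> ** transpose U"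

text \<open>lambda-hat_s: the s-th largest (i.e. smallest) diagonal entry of Lambda-hat.\<close>
definition lam_s :: "real^'s^'s \<Rightarrow> real" where
  "lam_s \<Lambda> = Min (range (\<lambda>i. \<Lambda> $ i $ i))"

definition nys_precond :: "real^'s^'d \<Rightarrow> real^'s^'s \<Rightarrow> real \<Rightarrow> real^'d^'d" where
  "nys_precond U \<Lambda> \<rho> =
     (1 / (lam_s \<Lambda> + \<rho>)) *\<^sub>R (U ** (\<Lambda> + \<rho> *\<^sub>R mat 1) ** transpose U)
     + (mat 1 - U ** transpose U)"

definition psd_sqrt :: "real^'n^'n \<Rightarrow> real^'n^'n" where
  "psd_sqrt A = (THE R. sym_psd R \<and> R ** R = A)"

definition inv_sqrt :: "real^'n^'n \<Rightarrow> real^'n^'n" where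
  "inv_sqrt A = psd_sqrt (matrix_inv A)"

definition cond2 :: "real^'n^'n \<Rightarrow> real" where
  "cond2 A = onorm (\<lambda>x. A *v x) * onorm (\<lambda>x. matrix_inv A *v x)"

end

theory Submission
  imports Defs
begin

text \<open>
  Put \<open>\<gamma> = \<epsilon> \<rho> / 6\<close>, \<open>D = H (H + \<gamma> I)\<^sup>-\<^sup>1\<close>, so that \<open>d_eff = tr D\<close>. Since the Nystrom approximation lies below
  \<open>H\<close> in the Loewner order, \<open>H\<close> dominates \<open>lam_s U U\<^sup>T\<close>, and antitonicity of the inverse gives
  \<open>s lam_s / (lam_s + \<gamma>) \<le> d_eff \<le> s / 8\<close>; this is the first claim. It also makes the lower half of the second
  claim trivial, because a condition number is at least 1. For the upper half,
  \<open>\<kappa> \<le> (lam_s + \<rho> + c) / \<rho>\<close> where \<open>c\<close> is the norm of the approximation error, and \<open>c \<le> 6 \<gamma>\<close> holds as soon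
  as no \<open>z\<close> with \<open>\<Omega>\<^sup>T H\<^sup>1\<^sup>/\<^sup>2 z = 0\<close> has Rayleigh quotient above \<open>6 \<gamma>\<close>.

  Such a \<open>z\<close> is excluded by a PAC-Bayesian argument. For fixed \<open>\<theta>\<close> the variable
  \<open>exp (- \<mu> |\<Omega>\<^sup>T \<theta>|\<^sup>2 + (s/2) ln (1 + 2 \<mu> |\<theta>|\<^sup>2))\<close> has expectation 1, hence so has its average over
  \<open>\<theta>\<close> drawn from the Gaussian with covariance \<open>D / \<beta>\<close>. Translating this Gaussian by \<open>H\<^sup>1\<^sup>/\<^sup>2 z\<close>, normalised by
  \<open>\<langle>z, (H + \<gamma> I) z\<rangle> = 1\<close>, costs only \<open>\<beta> / 2\<close> in the exponent, and Jensen's inequality bounds the average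
  from below by a quantity that is large unless \<open>tr (\<Omega>\<^sup>T D \<Omega>)\<close> is much larger than \<open>s tr D\<close>. Markov's
  inequality, applied to the average and to an exponential moment of that trace, finishes the proof.
\<close>

section \<open>Spectral theorem for symmetric matrices\<close>

lemma symmetric_matrix_inner:
  fixes A :: "real^'n^'n"
  assumes "transpose A = A"
  shows "x \<bullet> (A *v y) = (A *v x) \<bullet> y"
  by (metis assms dot_lmul_matrix vector_transpose_matrix)

text \<open>First-order optimality condition: near \<open>t = 0\<close> a linear term, whose sign
  \<open>t\<close> can choose, beats every quadratic term unless its slope is zero.\<close>

lemma linear_bounded_by_quadratic_imp_zero:
  fixes b c :: real
  assumes "\<And>t. t * b \<le> t\<^sup>2 * c"
  shows "b = 0"
proof (rule ccontr)
  assume b: "b \<noteq> 0"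
  \<comment> \<open>Positive and strictly above \<open>c\<close>, so that the linear term wins at
    the test point \<open>t = b / r\<close>.\<close>
  define r where "r = \<bar>c\<bar> + 1"
  have r: "r > 0" "c < r" by (auto simp: r_def)
  have "(b / r) * b \<le> (b / r)\<^sup>2 * c" by (rule assms)
  also have "\<dots> < (b / r)\<^sup>2 * r"
    using b r by (intro mult_strict_left_mono) auto
  also have "\<dots> = (b / r) * b" using r by (simp add: power2_eq_square)
  finally show False by simp
qed

text \<open>The orthogonal complement \<open>V\<close> of a set of eigenvectors is invariant under a
  symmetric matrix, and a maximiser of the quadratic form on the unit sphere of \<open>V\<close> is
  again an eigenvector.\<close>

lemma symmetric_extend_orthonormal_eigenvectors:
  fixes A :: "real^'n^'n" and B :: "(real^'n) set"
  assumes sym: "transpose A = A"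
    and fin: "finite B" "card B < CARD('n)"
    and eig: "\<And>b. b \<in> B \<Longrightarrow> \<exists>c. A *v b = c *\<^sub>R b"
  shows "\<exists>x m. norm x = 1 \<and> (\<forall>b\<in>B. orthogonal b x) \<and> A *v x = m *\<^sub>R x"
proof -
  define V where "V = {x. \<forall>b\<in>B. b \<bullet> x = 0}"
  define S where "S = V \<inter> sphere 0 1"
  have V_add: "x + t *\<^sub>R y \<in> V" if "x \<in> V" "y \<in> V" for x y t
    using that by (auto simp: V_def inner_simps)
  have V_diff: "x - t *\<^sub>R y \<in> V" if "x \<in> V" "y \<in> V" for x y t
    using that by (auto simp: V_def inner_simps)
  have V_scale: "t *\<^sub>R y \<in> V" if "y \<in> V" for y t
    using that by (auto simp: V_def inner_simps)
  have V_inv: "A *v x \<in> V" if "x \<in> V" for x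
  proof -
    have "b \<bullet> (A *v x) = 0" if b: "b \<in> B" for b
    proof -
      obtain c where "A *v b = c *\<^sub>R b" using eig[OF b] by blast
      then show ?thesis
        using symmetric_matrix_inner[OF sym, of b x] \<open>x \<in> V\<close> b by (simp add: V_def)
    qed
    then show ?thesis by (simp add: V_def)
  qed
  \<comment> \<open>Fewer vectors than the dimension cannot span, so \<open>V\<close> has a nonzero
    vector and its unit sphere is nonempty.\<close>
  have "dim B < DIM(real^'n)"
    using dim_le_card'[OF fin(1)] fin(2) by simp
  then have "span B \<noteq> UNIV"
    by (metis dim_UNIV dim_span less_irrefl)
  then obtain v where v: "v \<noteq> 0" "\<forall>b\<in>span B. orthogonal b v"
    using orthogonal_to_subspace_exists_gen[of B UNIV]
    by (metis orthogonal_commute psubsetI span_UNIV subset_UNIV)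
  then have vV: "v \<in> V"
    by (auto simp: V_def orthogonal_def span_base)
  have "(1 / norm v) *\<^sub>R v \<in> S"
    using v V_scale[OF vV] by (simp add: S_def)
  then have ne: "S \<noteq> {}" by blast
  have "V = (\<Inter>b\<in>B. {x. b \<bullet> x = 0})" by (auto simp: V_def)
  then have "closed V" by (auto intro!: closed_INT closed_hyperplane)
  then have "compact S" by (auto simp: S_def intro: closed_Int_compact)
  moreover have "continuous_on S (\<lambda>x. x \<bullet> (A *v x))"
    by (intro continuous_intros linear_continuous_on matrix_vector_mul_bounded_linear)
  ultimately obtain x where x: "x \<in> S" and max: "\<And>y. y \<in> S \<Longrightarrow> y \<bullet> (A *v y) \<le> x \<bullet> (A *v x)"
    using continuous_attains_sup[of S "\<lambda>x. x \<bullet> (A *v x)"] ne by blast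
  define m where "m = x \<bullet> (A *v x)"
  have xV: "x \<in> V" and xn: "x \<bullet> x = 1"
    using x by (auto simp: S_def dist_norm norm_eq_1)
  have le: "y \<bullet> (A *v y) \<le> m * (y \<bullet> y)" if "y \<in> V" for y
  proof (cases "y = 0")
    case False
    have "(1 / norm y) *\<^sub>R y \<in> S"
      using False V_scale[OF that] by (simp add: S_def)
    from max[OF this] have "(1 / norm y)\<^sup>2 * (y \<bullet> (A *v y)) \<le> m"
      by (simp add: m_def matrix_vector_mult_scaleR power2_eq_square)
    then show ?thesis
      using False by (simp add: field_simps power2_norm_eq_inner)
  qed simp
  have orth: "y \<bullet> (A *v x) = 0" if "y \<in> V" "x \<bullet> y = 0" for y
  proof -
    \<comment> \<open>The bound \<open>le\<close> at \<open>x + t *\<^sub>R y\<close>: the constant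
      terms cancel, which leaves a linear term in \<open>t\<close> against a quadratic one.\<close>
    have "t * (2 * (y \<bullet> (A *v x))) \<le> t\<^sup>2 * (m * (y \<bullet> y) - y \<bullet> (A *v y))" for t
    proof -
      have c: "x \<bullet> (A *v y) = y \<bullet> (A *v x)"
        using symmetric_matrix_inner[OF sym, of x y] by (simp add: inner_commute)
      have "(x + t *\<^sub>R y) \<bullet> (A *v (x + t *\<^sub>R y)) = m + t * (2 * (y \<bullet> (A *v x))) + t\<^sup>2 * (y \<bullet> (A *v y))"
        by (simp add: m_def c matrix_vector_right_distrib matrix_vector_mult_scaleR inner_add_left
            inner_add_right power2_eq_square algebra_simps)
      moreover have "(x + t *\<^sub>R y) \<bullet> (x + t *\<^sub>R y) = 1 + t\<^sup>2 * (y \<bullet> y)"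
        using that(2) xn by (simp add: inner_add_left inner_add_right inner_commute power2_eq_square)
      ultimately show ?thesis
        using le[OF V_add[OF xV that(1), of t]] by (simp add: algebra_simps)
    qed
    from linear_bounded_by_quadratic_imp_zero[OF this] show ?thesis by simp
  qed
  \<comment> \<open>The residual lies in \<open>V\<close> and is orthogonal to \<open>x\<close>,
    hence also to \<open>A *v x\<close>, and therefore to itself.\<close>
  define w where "w = A *v x - m *\<^sub>R x"
  have wV: "w \<in> V" unfolding w_def by (intro V_diff V_inv xV)
  have xw: "x \<bullet> w = 0" using xn by (simp add: w_def m_def inner_diff_right)
  have "w \<bullet> w = w \<bullet> (A *v x) - m * (x \<bullet> w)"
    by (simp add: w_def inner_diff_left inner_diff_right inner_commute algebra_simps)
  also have "\<dots> = 0" using orth[OF wV xw] xw by simp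
  finally have "A *v x = m *\<^sub>R x" by (simp add: w_def)
  moreover have "norm x = 1" using xn by (simp add: norm_eq_1)
  moreover have "\<forall>b\<in>B. orthogonal b x" using xV by (simp add: V_def orthogonal_def)
  ultimately show ?thesis by blast
qed

lemma symmetric_orthonormal_eigenvectors_of_card:
  fixes A :: "real^'n^'n"
  assumes sym: "transpose A = A" and "k \<le> CARD('n)"
  shows "\<exists>B. finite B \<and> card B = k \<and> pairwise orthogonal B \<and> (\<forall>b\<in>B. norm b = 1) \<and>
    (\<forall>b\<in>B. \<exists>c. A *v b = c *\<^sub>R b)"
  using assms(2)
proof (induction k)
  case 0
  show ?case by (intro exI[of _ "{}"]) simp
next
  case (Suc k)
  then obtain B where B: "finite B" "card B = k" "pairwise orthogonal B" "\<forall>b\<in>B. norm b = 1"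
    "\<forall>b\<in>B. \<exists>c. A *v b = c *\<^sub>R b" by auto
  obtain x m where x: "norm x = 1" "\<forall>b\<in>B. orthogonal b x" "A *v x = m *\<^sub>R x"
    using symmetric_extend_orthonormal_eigenvectors[OF sym B(1)] B(2,5) Suc.prems by auto
  have "x \<notin> B" using x by (metis norm_zero orthogonal_self zero_neq_one)
  then have "finite (insert x B)" "card (insert x B) = Suc k" using B by auto
  moreover have "pairwise orthogonal (insert x B)"
    using B(3) x(2) by (simp add: pairwise_insert orthogonal_commute)
  moreover have "\<forall>b\<in>insert x B. norm b = 1" "\<forall>b\<in>insert x B. \<exists>c. A *v b = c *\<^sub>R b"
    using B(4,5) x(1,3) by blast+
  ultimately show ?case by blast
qed

text \<open>Index type and coordinate type agree, so such a family has full cardinality and is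
  automatically an orthonormal basis.\<close>

definition orthonormal_family :: "('n \<Rightarrow> real^'n) \<Rightarrow> bool" where
  "orthonormal_family q \<longleftrightarrow> (\<forall>i j. q i \<bullet> q j = (if i = j then 1 else 0))"

text \<open>For orthonormal \<open>q\<close> this is the matrix with eigenvectors \<open>q i\<close>
  and eigenvalues \<open>f i\<close>. Fixing \<open>q\<close> turns algebra with functions of
  \<open>H\<close> into pointwise arithmetic on \<open>f\<close>.\<close>

definition spectral_matrix :: "('n \<Rightarrow> real^'n) \<Rightarrow> ('n \<Rightarrow> real) \<Rightarrow> real^'n^'n" where
  "spectral_matrix q f = matrix (\<lambda>x. \<Sum>i\<in>UNIV. (f i * (q i \<bullet> x)) *\<^sub>R q i)"

lemma spectral_matrix_mult_vec:
  "spectral_matrix q f *v x = (\<Sum>i\<in>UNIV. (f i * (q i \<bullet> x)) *\<^sub>R q i)"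
  unfolding spectral_matrix_def
  by (rule matrix_works, unfold scalar_mult_eq_scaleR[abs_def] linear_def[symmetric])
    (auto simp: linear_iff inner_add_right scaleR_sum_right algebra_simps sum.distrib[symmetric])

text \<open>Orthonormal vectors are independent, and there are as many as the dimension, so they
  span.\<close>

lemma orthonormal_family_expand:
  fixes q :: "'n \<Rightarrow> real^'n"
  assumes q: "orthonormal_family q"
  shows "(\<Sum>i\<in>UNIV. (q i \<bullet> x) *\<^sub>R q i) = x"
proof -
  have inj: "inj q"
    using q unfolding inj_def orthonormal_family_def by (metis zero_neq_one)
  have pw: "pairwise orthogonal (range q)"
    using q by (auto simp: pairwise_def orthogonal_def orthonormal_family_def)
  have nm: "norm b = 1" if "b \<in> range q" for b
    using q that by (auto simp: norm_eq_1 orthonormal_family_def)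
  then have "0 \<notin> range q" by (metis norm_zero zero_neq_one)
  then have "independent (range q)"
    using pairwise_orthogonal_independent[OF pw] by blast
  moreover have "card (range q) = DIM(real^'n)"
    using inj by (simp add: card_image)
  ultimately have "span (range q) = UNIV"
    using card_eq_dim[of "range q" UNIV] by auto
  then have "(\<Sum>b\<in>range q. (x \<bullet> b) *\<^sub>R b) = x"
    using orthonormal_basis_expand[OF pw nm, of x] by simp
  then show ?thesis
    by (simp add: sum.reindex[OF inj] inner_commute)
qed

theorem spectral_theorem_symmetric:
  fixes A :: "real^'n^'n"
  assumes sym: "transpose A = A"
  obtains q h where "orthonormal_family q" "A = spectral_matrix q h"
proof -
  obtain B :: "(real^'n) set" where B: "finite B" "card B = CARD('n)" "pairwise orthogonal B"
    "\<forall>b\<in>B. norm b = 1" "\<forall>b\<in>B. \<exists>c. A *v b = c *\<^sub>R b"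
    using symmetric_orthonormal_eigenvectors_of_card[OF sym order_refl] by auto
  obtain q where q: "bij_betw q (UNIV :: 'n set) B"
    using finite_same_card_bij[of "UNIV :: 'n set" B] B(1,2) by auto
  have qB: "q i \<in> B" for i using q by (auto simp: bij_betw_def)
  have on: "orthonormal_family q"
    unfolding orthonormal_family_def
  proof (intro allI)
    fix i j
    show "q i \<bullet> q j = (if i = j then 1 else 0)"
    proof (cases "i = j")
      case True
      then show ?thesis using B(4) qB[of i] by (simp add: norm_eq_1)
    next
      case False
      then have "q i \<noteq> q j" using q by (auto simp: bij_betw_def inj_def)
      then show ?thesis using False B(3) qB by (auto simp: pairwise_def orthogonal_def)
    qed
  qed
  have "\<forall>i. \<exists>c. A *v q i = c *\<^sub>R q i" using B(5) qB by blast
  from choice[OF this] obtain h where h: "\<And>i. A *v q i = h i *\<^sub>R q i" by blast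
  have "A *v x = spectral_matrix q h *v x" for x
  proof -
    have "A *v x = A *v (\<Sum>i\<in>UNIV. (q i \<bullet> x) *\<^sub>R q i)"
      by (simp only: orthonormal_family_expand[OF on])
    also have "\<dots> = (\<Sum>i\<in>UNIV. (q i \<bullet> x) *\<^sub>R (h i *\<^sub>R q i))"
      by (simp add: linear_sum[OF matrix_vector_mul_linear] matrix_vector_mult_scaleR h)
    finally show ?thesis by (simp add: spectral_matrix_mult_vec mult.commute)
  qed
  then have "A = spectral_matrix q h" by (simp add: matrix_eq)
  with on that show thesis by blast
qed

section \<open>Inverses, transposes and Gram matrices\<close>

lemma matrix_inv_eqI:
  fixes A B :: "real^'n^'n"
  assumes "A ** B = mat 1"
  shows "matrix_inv A = B"
proof -
  have "B ** A = mat 1" using assms by (simp add: matrix_left_right_inverse)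
  with assms have "invertible A" unfolding invertible_def by blast
  then have "matrix_inv A ** A = mat 1"
    unfolding invertible_def matrix_inv_def by (rule someI2_ex) blast
  then have "matrix_inv A ** (A ** B) = B"
    by (simp add: matrix_mul_assoc)
  then show ?thesis by (simp add: assms)
qed

lemma transpose_add: "transpose (A + B) = transpose A + transpose (B :: real^'n^'m)"
  by (simp add: transpose_def vec_eq_iff)

lemma transpose_diff: "transpose (A - B) = transpose A - transpose (B :: real^'n^'m)"
  by (simp add: transpose_def vec_eq_iff)

lemma transpose_scaleR: "transpose (c *\<^sub>R A) = c *\<^sub>R transpose (A :: real^'n^'m)"
  by (simp add: transpose_def vec_eq_iff)

lemma matrix_add_rdistrib: "(A + B) ** C = A ** C + B ** (C :: real^'n^'m)"
  by (simp add: matrix_matrix_mult_def vec_eq_iff sum.distrib algebra_simps)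

lemma matrix_diff_ldistrib: "A ** (B - C) = A ** B - A ** (C :: real^'n^'m)"
  by (simp add: matrix_matrix_mult_def vec_eq_iff sum_subtractf algebra_simps)

lemma matrix_diff_rdistrib: "(A - B) ** C = A ** C - B ** (C :: real^'n^'m)"
  by (simp add: matrix_matrix_mult_def vec_eq_iff sum_subtractf algebra_simps)

lemma inner_matrix_vector_transpose:
  fixes A :: "real^'n^'m"
  shows "x \<bullet> (A *v y) = (transpose A *v x) \<bullet> y"
  by (metis dot_lmul_matrix transpose_matrix_vector)

lemma matrix_eq_0_of_gram:
  fixes A :: "real^'n^'m"
  assumes "transpose A ** A = 0"
  shows "A = 0"
proof -
  have "A *v x = 0" for x
  proof -
    have "(A *v x) \<bullet> (A *v x) = (transpose A *v (A *v x)) \<bullet> x"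
      by (rule inner_matrix_vector_transpose)
    also have "\<dots> = 0" by (simp add: matrix_vector_mul_assoc assms)
    finally show ?thesis by simp
  qed
  then show ?thesis by (simp add: matrix_eq)
qed

section \<open>Functional calculus in an orthonormal eigenbasis\<close>

lemma inner_spectral_matrix:
  assumes "orthonormal_family q"
  shows "q i \<bullet> (spectral_matrix q f *v x) = f i * (q i \<bullet> x)"
proof -
  have "q i \<bullet> (spectral_matrix q f *v x) = (\<Sum>j\<in>UNIV. if j = i then f j * (q j \<bullet> x) else 0)"
    unfolding spectral_matrix_mult_vec inner_sum_right
    by (rule sum.cong) (use assms in \<open>auto simp: orthonormal_family_def\<close>)
  then show ?thesis by simp
qed

lemma spectral_matrix_eigenvector:
  assumes "orthonormal_family q"
  shows "spectral_matrix q f *v q i = f i *\<^sub>R q i"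
proof -
  have "spectral_matrix q f *v q i = (\<Sum>j\<in>UNIV. if j = i then f j *\<^sub>R q j else 0)"
    unfolding spectral_matrix_mult_vec
    by (rule sum.cong) (use assms in \<open>auto simp: orthonormal_family_def\<close>)
  then show ?thesis by simp
qed

lemma quadratic_spectral_matrix:
  "x \<bullet> (spectral_matrix q f *v y) = (\<Sum>i\<in>UNIV. f i * (q i \<bullet> x) * (q i \<bullet> y))"
  by (simp add: spectral_matrix_mult_vec inner_sum_right inner_commute mult_ac)

lemma spectral_matrix_mult:
  assumes "orthonormal_family q"
  shows "spectral_matrix q f ** spectral_matrix q g = spectral_matrix q (\<lambda>i. f i * g i)"
  by (simp add: matrix_eq matrix_vector_mul_assoc[symmetric] spectral_matrix_mult_vec[of q f]
      spectral_matrix_mult_vec[of q "\<lambda>i. f i * g i"] inner_spectral_matrix[OF assms] mult.assoc)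

lemma spectral_matrix_one:
  assumes "orthonormal_family q"
  shows "spectral_matrix q (\<lambda>_. 1) = mat 1"
  by (simp add: matrix_eq spectral_matrix_mult_vec orthonormal_family_expand[OF assms])

lemma spectral_matrix_add:
  "spectral_matrix q f + spectral_matrix q g = spectral_matrix q (\<lambda>i. f i + g i)"
  by (simp add: matrix_eq matrix_vector_mult_add_rdistrib spectral_matrix_mult_vec sum.distrib
      algebra_simps)

lemma spectral_matrix_scaleR:
  "c *\<^sub>R spectral_matrix q f = spectral_matrix q (\<lambda>i. c * f i)"
  by (simp add: matrix_eq scaleR_matrix_vector_assoc[symmetric] spectral_matrix_mult_vec scaleR_sum_right mult.assoc)

lemma spectral_matrix_shift:
  assumes "orthonormal_family q"
  shows "spectral_matrix q f + c *\<^sub>R mat 1 = spectral_matrix q (\<lambda>i. f i + c)"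
  unfolding spectral_matrix_one[OF assms, symmetric] spectral_matrix_scaleR spectral_matrix_add by simp

lemma spectral_matrix_nth:
  "spectral_matrix q f $ a $ b = (\<Sum>i\<in>UNIV. f i * (q i $ a * q i $ b))"
  by (simp add: spectral_matrix_def matrix_def sum_component inner_axis mult_ac)

lemma transpose_spectral_matrix: "transpose (spectral_matrix q f) = spectral_matrix q f"
  by (simp add: transpose_def vec_eq_iff spectral_matrix_nth mult.commute)

lemma trace_spectral_matrix:
  assumes "orthonormal_family q"
  shows "trace (spectral_matrix q f) = sum f UNIV"
proof -
  have "trace (spectral_matrix q f) = (\<Sum>i\<in>UNIV. f i * (q i \<bullet> q i))"
    unfolding trace_def spectral_matrix_nth
    by (subst sum.swap) (simp add: inner_vec_def sum_distrib_left)
  then show ?thesis using assms by (simp add: orthonormal_family_def)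
qed

lemma parseval:
  assumes "orthonormal_family q"
  shows "x \<bullet> y = (\<Sum>i\<in>UNIV. (q i \<bullet> x) * (q i \<bullet> y))"
  using quadratic_spectral_matrix[of x q "\<lambda>_. 1" y] by (simp add: spectral_matrix_one[OF assms])

text \<open>Each eigenvalue is the value of the quadratic form at a unit eigenvector.\<close>

lemma sym_psd_spectral:
  fixes A :: "real^'n^'n"
  assumes "sym_psd A"
  obtains q h where "orthonormal_family q" "A = spectral_matrix q h" "\<And>i. 0 \<le> h i"
proof -
  obtain q h where q: "orthonormal_family q" and A: "A = spectral_matrix q h"
    using spectral_theorem_symmetric assms unfolding sym_psd_def by metis
  have "0 \<le> h i" for i
  proof -
    have "0 \<le> q i \<bullet> (A *v q i)" using assms by (simp add: sym_psd_def)
    also have "\<dots> = h i"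
      using q by (simp add: A inner_spectral_matrix[OF q]) (simp add: orthonormal_family_def)
    finally show ?thesis .
  qed
  with q A that show thesis by blast
qed

lemma matrix_inv_spectral_matrix:
  assumes "orthonormal_family q" "\<And>i. f i \<noteq> 0"
  shows "matrix_inv (spectral_matrix q f) = spectral_matrix q (\<lambda>i. 1 / f i)"
  using assms by (intro matrix_inv_eqI) (simp add: spectral_matrix_mult spectral_matrix_one)

lemma d_eff_spectral_matrix:
  assumes q: "orthonormal_family q" and "\<And>i. 0 \<le> h i" "0 < \<sigma>"
  shows "d_eff (spectral_matrix q h) \<sigma> = (\<Sum>i\<in>UNIV. h i / (h i + \<sigma>))"
proof -
  have "h i + \<sigma> \<noteq> 0" for i using assms(2)[of i] assms(3) by linarith
  then show ?thesis
    by (simp add: d_eff_def spectral_matrix_shift[OF q] matrix_inv_spectral_matrix[OF q]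
        spectral_matrix_mult[OF q] trace_spectral_matrix[OF q])
qed

text \<open>Uniqueness of the psd square root without assuming that \<open>S\<close> and
  \<open>R\<close> commute. The identity
  \<open>S ** S - R ** R = S ** (S - R) + (S - R) ** R\<close>, tested on an eigenvector of
  \<open>S - R\<close> with nonzero eigenvalue, makes two nonnegative quadratic forms sum to zero;
  so both vanish, and with them the eigenvalue.\<close>

lemma psd_sqrt_square:
  fixes R :: "real^'n^'n"
  assumes R: "sym_psd R"
  shows "psd_sqrt (R ** R) = R"
  unfolding psd_sqrt_def
proof (rule the_equality)
  show "sym_psd R \<and> R ** R = R ** R" using R by simp
next
  fix S assume "sym_psd S \<and> S ** S = R ** R"
  then have S: "sym_psd S" and eq: "S ** S = R ** R" by auto
  have tr: "transpose S = S" "transpose R = R"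
    using S R by (auto simp: sym_psd_def)
  have "transpose (S - R) = S - R" by (simp add: transpose_diff tr)
  then obtain q h where q: "orthonormal_family q" and SR: "S - R = spectral_matrix q h"
    using spectral_theorem_symmetric by metis
  have "h i = 0" for i
  proof (rule ccontr)
    assume h: "h i \<noteq> 0"
    have qi: "q i \<bullet> q i = 1" using q by (simp add: orthonormal_family_def)
    have eig: "(S - R) *v q i = h i *\<^sub>R q i"
      by (simp add: SR spectral_matrix_eigenvector[OF q])
    have "0 = q i \<bullet> ((S ** S - R ** R) *v q i)" by (simp add: eq)
    also have "S ** S - R ** R = S ** (S - R) + (S - R) ** R"
      by (simp add: matrix_diff_ldistrib matrix_diff_rdistrib)
    also have "q i \<bullet> (\<dots> *v q i) = q i \<bullet> (S *v ((S - R) *v q i)) + ((S - R) *v q i) \<bullet> (R *v q i)"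
      using symmetric_matrix_inner[of "S - R" "q i" "R *v q i"] \<open>transpose (S - R) = S - R\<close>
      by (simp add: matrix_vector_mult_add_rdistrib matrix_vector_mul_assoc inner_add_right)
    also have "\<dots> = h i * (q i \<bullet> (S *v q i) + q i \<bullet> (R *v q i))"
      unfolding eig by (simp add: matrix_vector_mult_scaleR distrib_left)
    finally have "q i \<bullet> (S *v q i) + q i \<bullet> (R *v q i) = 0" using h by simp
    moreover have "0 \<le> q i \<bullet> (S *v q i)" "0 \<le> q i \<bullet> (R *v q i)"
      using S R by (auto simp: sym_psd_def)
    ultimately have "q i \<bullet> ((S - R) *v q i) = 0"
      by (simp add: matrix_vector_mult_diff_rdistrib inner_diff_right)
    then show False using h qi by (simp add: eig)
  qed
  then have "S - R = 0" by (simp add: SR matrix_eq spectral_matrix_mult_vec)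
  then show "S = R" by simp
qed

section \<open>The Nystrom approximation as a compressed projection\<close>

text \<open>Transposition reverses the order of symmetric products, which gives
  \<open>A ** X = A ** Y\<close> and \<open>X ** A = Y ** A\<close>. Uniqueness is what gives the
  definite description in \<open>pinv\<close> a value.\<close>

lemma penrose_inverse_unique:
  fixes A :: "real^'n^'m"
  assumes X: "A ** X ** A = A" "X ** A ** X = X" "transpose (A ** X) = A ** X" "transpose (X ** A) = X ** A"
    and Y: "A ** Y ** A = A" "Y ** A ** Y = Y" "transpose (A ** Y) = A ** Y" "transpose (Y ** A) = Y ** A"
  shows "X = Y"
proof -
  have "A ** X = transpose (A ** X) "by (simp add: X)
  also have "\<dots> = transpose (A ** Y ** A ** X)" by (simp add: Y)
  also have "\<dots> = transpose (A ** X) ** transpose (A ** Y)"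
    by (simp add: matrix_transpose_mul[symmetric] matrix_mul_assoc)
  also have "\<dots> = A ** Y" by (simp add: X Y matrix_mul_assoc)
  finally have AX: "A ** X = A ** Y" .
  have "X ** A = transpose (X ** A) "by (simp add: X)
  also have "\<dots> = transpose (X ** (A ** Y ** A))" by (simp add: Y)
  also have "\<dots> = transpose (Y ** A) ** transpose (X ** A)"
    by (simp add: matrix_transpose_mul[symmetric] matrix_mul_assoc)
  also have "\<dots> = (Y ** A) ** (X ** A)" by (simp only: X(4) Y(4))
  also have "\<dots> = Y ** (A ** X ** A)" by (simp only: matrix_mul_assoc)
  also have "\<dots> = Y ** A" by (simp only: X(1))
  finally have XA: "X ** A = Y ** A" .
  have "X = X ** (A ** X)" using X(2) by (simp add: matrix_mul_assoc)
  also have "\<dots> = Y ** A ** Y" by (simp add: AX matrix_mul_assoc XA)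
  finally show ?thesis by (simp add: Y)
qed

lemma pinv_symmetric:
  fixes G :: "real^'n^'n"
  assumes sym: "transpose G = G"
  shows "G ** pinv G ** G = G" "pinv G ** G ** pinv G = pinv G" "transpose (pinv G) = pinv G"
proof -
  obtain q g where q: "orthonormal_family q" and G: "G = spectral_matrix q g"
    using spectral_theorem_symmetric[OF sym] by metis
  \<comment> \<open>Since \<open>inverse 0 = 0\<close>, this inverts the nonzero eigenvalues and
    stays zero on the kernel.\<close>
  define X where "X = spectral_matrix q (\<lambda>i. inverse (g i))"
  have P: "G ** X ** G = G \<and> X ** G ** X = X \<and> transpose (G ** X) = G ** X \<and> transpose (X ** G) = X ** G"
    unfolding G X_def spectral_matrix_mult[OF q] transpose_spectral_matrix
    by (auto intro!: arg_cong[where f = "spectral_matrix q"] ext simp: field_simps)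
  have "pinv G = X"
    unfolding pinv_def
  proof (rule the_equality)
    fix Z assume "G ** Z ** G = G \<and> Z ** G ** Z = Z \<and> transpose (G ** Z) = G ** Z \<and> transpose (Z ** G) = Z ** G"
    then show "Z = X" using P by (intro penrose_inverse_unique[of G Z X]) auto
  qed (rule P)
  then show "G ** pinv G ** G = G" "pinv G ** G ** pinv G = pinv G" "transpose (pinv G) = pinv G"
    using P by (auto simp: X_def transpose_spectral_matrix)
qed

text \<open>\<open>K\<close> is the orthogonal projection onto the column space of
  \<open>R ** \<Omega>\<close>. The third property places the range of its complement in the kernel
  of \<open>transpose \<Omega> ** R\<close>, which is where the random event will control
  \<open>H\<close>.\<close>

lemma nystrom_projection:
  fixes H R :: "real^'d^'d" and \<Omega> :: "real^'s^'d"
  assumes R: "transpose R = R" "R ** R = H"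
  obtains K where "transpose K = K" "K ** K = K" "transpose \<Omega> ** R ** (mat 1 - K) = 0"
    "nystrom H \<Omega> = R ** K ** R"
proof -
  define Y where "Y = R ** \<Omega>"
  define G where "G = transpose Y ** Y"
  have YT: "transpose Y = transpose \<Omega> ** R" by (simp add: Y_def matrix_transpose_mul R)
  have G: "transpose \<Omega> ** H ** \<Omega> = G"
    unfolding G_def YT R(2)[symmetric] by (simp add: Y_def matrix_mul_assoc)
  have Gs: "transpose G = G" by (simp add: G_def matrix_transpose_mul transpose_transpose)
  note pinv = pinv_symmetric[OF Gs]
  define K where "K = Y ** pinv G ** transpose Y"
  have "transpose K = K"
    by (simp add: K_def matrix_transpose_mul transpose_transpose pinv matrix_mul_assoc)
  moreover have "K ** K = Y ** (pinv G ** G ** pinv G) ** transpose Y"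
    unfolding K_def G_def by (simp add: matrix_mul_assoc)
  then have "K ** K = K" by (simp add: pinv K_def)
  moreover have "transpose \<Omega> ** R ** (mat 1 - K) = 0"
  proof -
    \<comment> \<open>\<open>N\<close> annihilates \<open>G\<close>, so the Gram matrix of
      \<open>Y ** transpose N\<close> vanishes and \<open>N\<close> annihilates
      \<open>transpose Y\<close> too.\<close>
    define N where "N = mat 1 - G ** pinv G"
    have N: "transpose N = mat 1 - pinv G ** G"
      by (simp add: N_def transpose_diff matrix_transpose_mul pinv Gs transpose_mat)
    have "transpose (Y ** transpose N) ** (Y ** transpose N) = N ** G ** transpose N"
      by (simp add: matrix_transpose_mul transpose_transpose G_def matrix_mul_assoc)
    also have "N ** G = 0"
      by (simp add: N_def matrix_diff_rdistrib pinv)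
    also have "0 ** transpose N = (0 :: real^'s^'s)" by (simp add: matrix_matrix_mult_def vec_eq_iff)
    finally have "Y ** transpose N = 0" by (rule matrix_eq_0_of_gram)
    then have "transpose (Y ** transpose N) = 0" by (simp add: transpose_def vec_eq_iff)
    then have "N ** transpose Y = 0" by (simp add: matrix_transpose_mul transpose_transpose)
    moreover have "transpose Y ** (mat 1 - K) = N ** transpose Y"
      by (simp add: N_def K_def G_def matrix_diff_ldistrib matrix_diff_rdistrib matrix_mul_assoc)
    ultimately show ?thesis by (simp add: YT)
  qed
  moreover have "nystrom H \<Omega> = R ** K ** R"
  proof -
    have "H ** \<Omega> = R ** Y" by (simp add: Y_def matrix_mul_assoc R)
    then show ?thesis
      by (simp add: nystrom_def G K_def matrix_transpose_mul R matrix_mul_assoc)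
  qed
  ultimately show thesis using that by blast
qed

lemma sym_psd_sqrt_exists:
  assumes "sym_psd H"
  obtains R where "transpose R = R" "R ** R = H"
proof -
  obtain q h where q: "orthonormal_family q" and H: "H = spectral_matrix q h" and h: "\<And>i. 0 \<le> h i"
    using sym_psd_spectral[OF assms] by metis
  have "spectral_matrix q (\<lambda>i. sqrt (h i)) ** spectral_matrix q (\<lambda>i. sqrt (h i)) = H"
    using h by (simp add: spectral_matrix_mult[OF q] H)
  then show thesis using that transpose_spectral_matrix by blast
qed

text \<open>An orthogonal projection lies between 0 and the identity in the Loewner order;
  conjugating by \<open>R\<close> preserves this.\<close>

lemma nystrom_between:
  fixes H :: "real^'d^'d" and \<Omega> :: "real^'s^'d"
  assumes "sym_psd H"
  shows "0 \<le> x \<bullet> (nystrom H \<Omega> *v x)" "x \<bullet> (nystrom H \<Omega> *v x) \<le> x \<bullet> (H *v x)"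
proof -
  obtain R where R: "transpose R = R" "R ** R = H" by (rule sym_psd_sqrt_exists[OF assms])
  obtain K where K: "transpose K = K" "K ** K = K" "nystrom H \<Omega> = R ** K ** R"
    using nystrom_projection[OF R, of \<Omega>] by metis
  have 1: "x \<bullet> (nystrom H \<Omega> *v x) = (R *v x) \<bullet> (K *v (R *v x))"
    by (simp add: K(3) matrix_vector_mul_assoc[symmetric] symmetric_matrix_inner[OF R(1)])
  have 2: "v \<bullet> (K *v v) = (K *v v) \<bullet> (K *v v)" for v
    by (metis K(1,2) matrix_vector_mul_assoc symmetric_matrix_inner)
  show "0 \<le> x \<bullet> (nystrom H \<Omega> *v x)" by (simp add: 1 2)
  have 3: "x \<bullet> (H *v x) = (R *v x) \<bullet> (R *v x)"
    by (simp add: R(2)[symmetric] matrix_vector_mul_assoc[symmetric] symmetric_matrix_inner[OF R(1)])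
  have "v \<bullet> (K *v v) \<le> v \<bullet> v" for v
  proof -
    have "0 \<le> (v - K *v v) \<bullet> (v - K *v v)" by simp
    also have "\<dots> = v \<bullet> v - v \<bullet> (K *v v)"
      using 2[of v] by (simp add: inner_diff_left inner_diff_right inner_commute)
    finally show ?thesis by simp
  qed
  then show "x \<bullet> (nystrom H \<Omega> *v x) \<le> x \<bullet> (H *v x)" by (simp add: 1 3)
qed

text \<open>The error form at \<open>x\<close> is \<open>z \<bullet> z\<close> with \<open>z\<close>
  the part of \<open>R *v x\<close> outside the range of \<open>K\<close>. This \<open>z\<close>
  satisfies the kernel condition, and \<open>z \<bullet> z = x \<bullet> (R *v z)\<close>, so
  Cauchy-Schwarz moves the bound on \<open>R *v z\<close> to a bound in terms of
  \<open>x\<close>.\<close>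

lemma nystrom_error_le:
  fixes H R :: "real^'d^'d" and \<Omega> :: "real^'s^'d"
  assumes R: "transpose R = R" "R ** R = H" and c: "0 \<le> c"
    and ker: "\<And>z. transpose \<Omega> *v (R *v z) = 0 \<Longrightarrow> z \<bullet> (H *v z) \<le> c * (z \<bullet> z)"
  shows "x \<bullet> (H *v x) \<le> x \<bullet> (nystrom H \<Omega> *v x) + c * (x \<bullet> x)"
proof -
  obtain K where K: "transpose K = K" "K ** K = K" "transpose \<Omega> ** R ** (mat 1 - K) = 0"
    "nystrom H \<Omega> = R ** K ** R"
    using nystrom_projection[OF R, of \<Omega>] by metis
  define v where "v = R *v x"
  define z where "z = v - K *v v"
  have "z = (mat 1 - K) *v v" by (simp add: z_def matrix_vector_mult_diff_rdistrib)
  then have "transpose \<Omega> *v (R *v z) = 0"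
    by (simp add: matrix_vector_mul_assoc matrix_mul_assoc K(3))
  from ker[OF this] have Rz: "(R *v z) \<bullet> (R *v z) \<le> c * (z \<bullet> z)"
    by (simp add: R(2)[symmetric] matrix_vector_mul_assoc[symmetric] symmetric_matrix_inner[OF R(1)])
  have 2: "v \<bullet> (K *v v) = (K *v v) \<bullet> (K *v v)"
    by (metis K(1,2) matrix_vector_mul_assoc symmetric_matrix_inner)
  have zz: "z \<bullet> z = v \<bullet> z" "z \<bullet> z = v \<bullet> v - v \<bullet> (K *v v)"
    using 2 by (simp_all add: z_def inner_diff_left inner_diff_right inner_commute)
  have "z \<bullet> z = x \<bullet> (R *v z)"
    by (simp add: zz(1)) (simp add: v_def symmetric_matrix_inner[OF R(1)])
  then have "(z \<bullet> z) * (z \<bullet> z) \<le> (x \<bullet> x) * ((R *v z) \<bullet> (R *v z))"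
    using Cauchy_Schwarz_ineq[of x "R *v z"] by (simp add: power2_eq_square)
  also have "\<dots> \<le> (x \<bullet> x) * (c * (z \<bullet> z))" by (intro mult_left_mono Rz) simp
  finally have "(z \<bullet> z) * (z \<bullet> z) \<le> (c * (x \<bullet> x)) * (z \<bullet> z)" by (simp add: mult_ac)
  then have "z \<bullet> z \<le> c * (x \<bullet> x)"
    using c by (cases "z = 0") (auto simp: mult_le_cancel_right)
  moreover have "x \<bullet> (H *v x) = v \<bullet> v"
    by (simp add: v_def R(2)[symmetric] matrix_vector_mul_assoc[symmetric] symmetric_matrix_inner[OF R(1)])
  moreover have "x \<bullet> (nystrom H \<Omega> *v x) = v \<bullet> (K *v v)"
    by (simp add: v_def K(4) matrix_vector_mul_assoc[symmetric] symmetric_matrix_inner[OF R(1)])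
  ultimately show ?thesis using zz(2) by simp
qed

section \<open>Condition number of the preconditioned matrix\<close>

declare transpose_matrix_vector [simp del]

lemma norm_spectral_matrix_le:
  assumes q: "orthonormal_family q" and f: "\<And>i. \<bar>f i\<bar> \<le> c"
  shows "norm (spectral_matrix q f *v x) \<le> c * norm x"
proof -
  have c: "0 \<le> c" using f[of undefined] by linarith
  have "(spectral_matrix q f *v x) \<bullet> (spectral_matrix q f *v x) = (\<Sum>i\<in>UNIV. (f i)\<^sup>2 * (q i \<bullet> x)\<^sup>2)"
    by (subst parseval[OF q]) (simp add: inner_spectral_matrix[OF q] power2_eq_square mult_ac)
  also have "\<dots> \<le> (\<Sum>i\<in>UNIV. c\<^sup>2 * (q i \<bullet> x)\<^sup>2)"
    using f c by (intro sum_mono mult_right_mono) (auto simp: abs_le_square_iff[symmetric])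
  also have "\<dots> = c\<^sup>2 * (x \<bullet> x)"
    by (subst parseval[OF q, of x x]) (simp add: sum_distrib_left power2_eq_square)
  finally have "(norm (spectral_matrix q f *v x))\<^sup>2 \<le> (c * norm x)\<^sup>2"
    by (simp add: power2_norm_eq_inner power_mult_distrib)
  then show ?thesis using c by (simp add: power2_le_iff_abs_le)
qed

text \<open>All eigenvalues lie in \<open>[m, c]\<close>, which bounds the two operator norms by
  \<open>c\<close> and \<open>1 / m\<close>. The lower bound 1 is submultiplicativity applied to the
  identity.\<close>

lemma cond2_bounds:
  fixes A :: "real^'n^'n"
  assumes sym: "transpose A = A" and m: "0 < m"
    and lo: "\<And>x. m * (x \<bullet> x) \<le> x \<bullet> (A *v x)" and up: "\<And>x. x \<bullet> (A *v x) \<le> c * (x \<bullet> x)"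
  shows "1 \<le> cond2 A" "cond2 A \<le> c / m"
proof -
  obtain q a where q: "orthonormal_family q" and A: "A = spectral_matrix q a"
    using spectral_theorem_symmetric[OF sym] by metis
  have "q i \<bullet> q i = 1" for i using q by (simp add: orthonormal_family_def)
  then have a: "m \<le> a i" "a i \<le> c" for i
    using lo[of "q i"] up[of "q i"] by (simp_all add: A inner_spectral_matrix[OF q])
  have pos: "0 < a i" for i using a(1)[of i] m by linarith
  have inv: "matrix_inv A = spectral_matrix q (\<lambda>i. 1 / a i)"
    unfolding A using pos by (intro matrix_inv_spectral_matrix[OF q]) (metis less_irrefl)
  have 1: "onorm (\<lambda>x. A *v x) \<le> c"
    unfolding A using a(2) pos
    by (intro onorm_le norm_spectral_matrix_le[OF q]) (metis abs_of_pos)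
  have "\<bar>1 / a i\<bar> \<le> 1 / m" for i
    using a(1)[of i] pos[of i] m by (simp add: frac_le)
  then have 2: "onorm (\<lambda>x. matrix_inv A *v x) \<le> 1 / m"
    unfolding inv by (intro onorm_le norm_spectral_matrix_le[OF q])
  have bl: "bounded_linear (\<lambda>x. A *v x)" "bounded_linear (\<lambda>x. matrix_inv A *v x)"
    by (rule matrix_vector_mul_bounded_linear)+
  have c: "0 \<le> c" using a[of undefined] m by linarith
  show "cond2 A \<le> c / m"
    unfolding cond2_def using mult_mono[OF 1 2 c onorm_pos_le[OF bl(2)]] by simp
  have "matrix_inv A ** A = mat 1"
    unfolding inv unfolding A using pos
    by (simp add: spectral_matrix_mult[OF q] less_imp_neq[symmetric] spectral_matrix_one[OF q])
  then have 3: "norm v \<le> onorm (\<lambda>x. matrix_inv A *v x) * norm (A *v v)" for v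
    using onorm[OF bl(2), of "A *v v"] by (simp add: matrix_vector_mul_assoc)
  have "norm v \<le> onorm (\<lambda>x. matrix_inv A *v x) * (onorm (\<lambda>x. A *v x) * norm v)" for v :: "real^'n"
    using 3[of v] mult_left_mono[OF onorm[OF bl(1), of v] onorm_pos_le[OF bl(2)]] by linarith
  \<comment> \<open>Any nonzero vector would do; a coordinate vector has norm 1.\<close>
  from this[of "axis undefined 1"] show "1 \<le> cond2 A"
    by (simp add: cond2_def mult.commute)
qed

section \<open>Operators that are diagonal on the columns of \<open>U\<close> and the identity on
  their complement\<close>

definition diagonal_matrix :: "('n \<Rightarrow> real) \<Rightarrow> real^'n^'n" where
  "diagonal_matrix a = (\<chi> i j. if i = j then a i else 0)"

lemma diagonal_matrix_mult_vec: "diagonal_matrix a *v x = (\<chi> i. a i * x $ i)"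
  by (simp add: diagonal_matrix_def matrix_vector_mult_def vec_eq_iff if_distrib if_distribR cong: if_cong)

lemma diagonal_matrix_mult:
  "diagonal_matrix a ** diagonal_matrix b = diagonal_matrix (\<lambda>i. a i * b i)"
  by (simp add: matrix_eq matrix_vector_mul_assoc[symmetric] diagonal_matrix_mult_vec mult.assoc)

lemma transpose_diagonal_matrix: "transpose (diagonal_matrix a) = diagonal_matrix a"
  by (auto simp: diagonal_matrix_def transpose_def vec_eq_iff)

lemma diagonal_matrix_one: "diagonal_matrix (\<lambda>_. 1) = mat 1"
  by (simp add: diagonal_matrix_def mat_def vec_eq_iff)

text \<open>Common shape of the preconditioner, its inverse and its inverse square root, so that all
  three are computed on the scaling factors \<open>a\<close>.\<close>

definition column_scaling :: "real^'s^'d \<Rightarrow> ('s \<Rightarrow> real) \<Rightarrow> real^'d^'d" where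
  "column_scaling U a = U ** diagonal_matrix a ** transpose U + (mat 1 - U ** transpose U)"

lemma transpose_mult_column_scaling:
  assumes U: "transpose U ** U = mat 1"
  shows "transpose U ** column_scaling U a = diagonal_matrix a ** transpose U"
proof -
  have "transpose U ** column_scaling U a = (transpose U ** U) ** diagonal_matrix a ** transpose U
      + (transpose U - (transpose U ** U) ** transpose U)"
    by (simp add: column_scaling_def matrix_add_ldistrib matrix_diff_ldistrib matrix_mul_assoc)
  then show ?thesis by (simp add: U)
qed

lemma transpose_column_scaling: "transpose (column_scaling U a) = column_scaling U a"
  by (simp add: column_scaling_def transpose_add transpose_diff matrix_transpose_mul
      transpose_transpose transpose_diagonal_matrix transpose_mat matrix_mul_assoc)

text \<open>Only the left factor is expanded; \<open>transpose U\<close> then passes through the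
  right one as a diagonal matrix.\<close>

lemma column_scaling_mult:
  assumes U: "transpose U ** U = mat 1"
  shows "column_scaling U a ** column_scaling U b = column_scaling U (\<lambda>i. a i * b i)"
proof -
  have *: "(X ** transpose U) ** column_scaling U b = X ** diagonal_matrix b ** transpose U" for X :: "real^_^'c"
    by (simp add: matrix_mul_assoc[symmetric] transpose_mult_column_scaling[OF U])
  have "column_scaling U a ** column_scaling U b
      = (U ** diagonal_matrix a) ** transpose U ** column_scaling U b
        + (column_scaling U b - U ** transpose U ** column_scaling U b)"
    by (subst (1) column_scaling_def) (simp add: matrix_add_rdistrib matrix_diff_rdistrib)
  also have "\<dots> = U ** diagonal_matrix (\<lambda>i. a i * b i) ** transpose U
        + (column_scaling U b - U ** diagonal_matrix b ** transpose U)"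
    unfolding * by (simp add: matrix_mul_assoc[symmetric] diagonal_matrix_mult[symmetric])
  finally show ?thesis by (simp add: column_scaling_def)
qed

lemma column_scaling_one: "column_scaling U (\<lambda>_. 1) = mat 1"
  by (simp add: column_scaling_def diagonal_matrix_one)

lemma quadratic_diagonal:
  fixes U :: "real^'s^'d"
  shows "x \<bullet> ((U ** diagonal_matrix a ** transpose U) *v x) = (\<Sum>j\<in>UNIV. a j * ((transpose U *v x) $ j)\<^sup>2)"
  by (simp add: matrix_vector_mul_assoc[symmetric] inner_matrix_vector_transpose[of x U]
      diagonal_matrix_mult_vec) (simp add: inner_vec_def power2_eq_square mult_ac)

text \<open>Bessel's inequality for the orthonormal columns of \<open>U\<close>.\<close>

lemma norm_transpose_mult_le:
  fixes U :: "real^'s^'d"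
  assumes U: "transpose U ** U = mat 1"
  shows "(transpose U *v x) \<bullet> (transpose U *v x) \<le> x \<bullet> x"
proof -
  let ?w = "transpose U *v x"
  have w: "(U *v ?w) \<bullet> (U *v ?w) = ?w \<bullet> ?w" "x \<bullet> (U *v ?w) = ?w \<bullet> ?w"
    using inner_matrix_vector_transpose[of x U ?w] inner_matrix_vector_transpose[of "U *v ?w" U ?w]
      matrix_vector_mul_assoc[of "transpose U" U ?w] by (simp_all add: U)
  have "0 \<le> (x - U *v ?w) \<bullet> (x - U *v ?w)" by simp
  also have "\<dots> = x \<bullet> x - ?w \<bullet> ?w"
    using w by (simp add: inner_diff_left inner_diff_right inner_commute)
  finally show ?thesis by simp
qed

lemma quadratic_column_scaling:
  "x \<bullet> (column_scaling U a *v x) =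
    (\<Sum>j\<in>UNIV. a j * ((transpose U *v x) $ j)\<^sup>2) + (x \<bullet> x - (transpose U *v x) \<bullet> (transpose U *v x))"
proof -
  have "x \<bullet> ((U ** transpose U) *v x) = (transpose U *v x) \<bullet> (transpose U *v x)"
    by (simp add: matrix_vector_mul_assoc[symmetric] inner_matrix_vector_transpose[of x U])
  then show ?thesis
    by (simp add: column_scaling_def matrix_vector_mult_add_rdistrib matrix_vector_mult_diff_rdistrib
        inner_add_right inner_diff_right quadratic_diagonal)
qed

lemma sym_psd_column_scaling:
  assumes "transpose U ** U = mat 1" "\<And>j. 0 \<le> a j"
  shows "sym_psd (column_scaling U a)"
  using norm_transpose_mult_le[OF assms(1)] assms(2)
  by (auto simp: sym_psd_def transpose_column_scaling quadratic_column_scaling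
      intro!: add_nonneg_nonneg sum_nonneg)

lemma inv_sqrt_column_scaling:
  assumes U: "transpose U ** U = mat 1" and a: "\<And>j. 0 < a j"
  shows "inv_sqrt (column_scaling U a) = column_scaling U (\<lambda>j. sqrt (1 / a j))"
proof -
  have a': "0 \<le> a j" "a j \<noteq> 0" for j using a[of j] by auto
  have "matrix_inv (column_scaling U a) = column_scaling U (\<lambda>j. 1 / a j)"
    by (intro matrix_inv_eqI) (simp add: column_scaling_mult[OF U] a' column_scaling_one)
  also have "\<dots> = column_scaling U (\<lambda>j. sqrt (1 / a j)) ** column_scaling U (\<lambda>j. sqrt (1 / a j))"
    by (simp add: column_scaling_mult[OF U] a' real_sqrt_mult_self del: real_sqrt_divide)
  finally show ?thesis
    unfolding inv_sqrt_def
    by (simp add: psd_sqrt_square[OF sym_psd_column_scaling[OF U]] a' del: real_sqrt_divide)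
qed

section \<open>The preconditioner and the condition number it achieves\<close>

lemma nystrom_eig_diagonal:
  assumes "nystrom_eig H \<Omega> U \<Lambda>"
  shows "transpose U ** U = mat 1" "\<Lambda> = diagonal_matrix (\<lambda>j. \<Lambda> $ j $ j)"
    "nystrom H \<Omega> = U ** diagonal_matrix (\<lambda>j. \<Lambda> $ j $ j) ** transpose U"
proof -
  show "\<Lambda> = diagonal_matrix (\<lambda>j. \<Lambda> $ j $ j)"
    using assms by (auto simp: nystrom_eig_def diagonal_matrix_def vec_eq_iff)
  then show "transpose U ** U = mat 1"
    "nystrom H \<Omega> = U ** diagonal_matrix (\<lambda>j. \<Lambda> $ j $ j) ** transpose U"
    using assms by (auto simp: nystrom_eig_def)
qed

lemma lam_s_le: "lam_s \<Lambda> \<le> \<Lambda> $ j $ j"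
  unfolding lam_s_def by (rule Min_le) auto

text \<open>The columns of \<open>U\<close> are eigenvectors of the psd Nystrom
  approximation.\<close>

lemma lam_s_nonneg:
  fixes H :: "real^'d^'d" and \<Omega> :: "real^'s^'d"
  assumes H: "sym_psd H" and ne: "nystrom_eig H \<Omega> U \<Lambda>"
  shows "0 \<le> lam_s \<Lambda>"
proof -
  note U = nystrom_eig_diagonal[OF ne]
  have "0 \<le> \<Lambda> $ j $ j" for j
  proof -
    have "transpose U *v (U *v axis j 1) = axis j 1"
      by (simp add: matrix_vector_mul_assoc U)
    then have "(U *v axis j 1) \<bullet> (nystrom H \<Omega> *v (U *v axis j 1)) = (\<Sum>i\<in>UNIV. \<Lambda> $ i $ i * (axis j 1 $ i)\<^sup>2)"
      unfolding U(3) quadratic_diagonal by simp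
    also have "\<dots> = \<Lambda> $ j $ j"
      by (subst sum.remove[of _ j]) (auto simp: axis_def intro!: sum.neutral)
    finally show ?thesis using nystrom_between(1)[OF H] by metis
  qed
  then show ?thesis unfolding lam_s_def by (subst Min_ge_iff) auto
qed

lemma nys_precond_column_scaling:
  assumes ne: "nystrom_eig H \<Omega> U \<Lambda>"
  shows "nys_precond U \<Lambda> \<rho> = column_scaling U (\<lambda>j. (\<Lambda> $ j $ j + \<rho>) / (lam_s \<Lambda> + \<rho>))"
proof -
  have "(1 / (lam_s \<Lambda> + \<rho>)) *\<^sub>R (\<Lambda> + \<rho> *\<^sub>R mat 1) = diagonal_matrix (\<lambda>j. (\<Lambda> $ j $ j + \<rho>) / (lam_s \<Lambda> + \<rho>))"
    using ne by (auto simp: nystrom_eig_def diagonal_matrix_def vec_eq_iff mat_def)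
  moreover have "c *\<^sub>R (U ** X ** transpose U) = U ** (c *\<^sub>R X) ** transpose U" for c :: real and X
    by (simp add: matrix_eq scaleR_matrix_vector_assoc[symmetric] matrix_vector_mul_assoc[symmetric]
        matrix_vector_mult_scaleR)
  ultimately show ?thesis by (simp add: nys_precond_def column_scaling_def)
qed

text \<open>With \<open>S\<close> the inverse square root of \<open>P\<close>, conjugating the
  regularised Nystrom approximation gives exactly \<open>ls\<close> times the projection
  \<open>U ** transpose U\<close> plus \<open>\<rho>\<close> times the identity. Replacing the
  approximation by \<open>H\<close> can only increase the form, and by at most \<open>c\<close>,
  because \<open>S\<close> is a contraction.\<close>

lemma cond2_preconditioned_bounds:
  fixes H :: "real^'d^'d" and \<Omega> :: "real^'s^'d"
  assumes H: "sym_psd H" and rho: "0 < \<rho>" and ne: "nystrom_eig H \<Omega> U \<Lambda>" and c: "0 \<le> c"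
    and err: "\<And>x. x \<bullet> (H *v x) \<le> x \<bullet> (nystrom H \<Omega> *v x) + c * (x \<bullet> x)"
  defines "P \<equiv> nys_precond U \<Lambda> \<rho>"
  defines "A \<equiv> inv_sqrt P ** (H + \<rho> *\<^sub>R mat 1) ** inv_sqrt P"
  shows "1 \<le> cond2 A" "cond2 A \<le> (lam_s \<Lambda> + \<rho> + c) / \<rho>"
proof -
  note U = nystrom_eig_diagonal[OF ne]
  define l where "l j = \<Lambda> $ j $ j" for j
  define ls where "ls = lam_s \<Lambda>"
  have ls: "0 \<le> ls" "ls \<le> l j" for j
    using lam_s_nonneg[OF H ne] lam_s_le by (auto simp: ls_def l_def)
  define p where "p j = (l j + \<rho>) / (ls + \<rho>)" for j
  \<comment> \<open>\<open>p j\<close> is at least 1 because \<open>ls\<close> is the smallest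
    diagonal entry; the last equation is the cancellation that flattens the spectrum.\<close>
  have p: "0 < p j" "1 / p j \<le> 1" "(l j + \<rho>) * (1 / p j) = ls + \<rho>" for j
    using ls(1) ls(2)[of j] rho by (auto simp: p_def field_simps)
  define S where "S = column_scaling U (\<lambda>j. sqrt (1 / p j))"
  have S: "inv_sqrt P = S"
    unfolding P_def nys_precond_column_scaling[OF ne] S_def p_def ls_def l_def
    by (rule inv_sqrt_column_scaling[OF U(1)]) (use p(1) in \<open>simp add: p_def ls_def l_def\<close>)
  have St: "transpose S = S" by (simp add: S_def transpose_column_scaling)
  have Ht: "transpose H = H" using H by (simp add: sym_psd_def)
  have At: "transpose A = A"
    by (simp add: A_def S matrix_transpose_mul St transpose_add transpose_scaleR Ht transpose_mat matrix_mul_assoc)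
  have quad: "x \<bullet> (A *v x) = (S *v x) \<bullet> (H *v (S *v x)) + \<rho> * ((S *v x) \<bullet> (S *v x))" for x
    by (simp add: A_def S matrix_vector_mul_assoc[symmetric] symmetric_matrix_inner[OF St, of x]
        matrix_vector_mult_add_rdistrib scaleR_matrix_vector_assoc[symmetric] inner_add_right)
  have SS: "S ** S = column_scaling U (\<lambda>j. 1 / p j)"
    using p(1) by (simp add: S_def column_scaling_mult[OF U(1)] less_imp_le del: real_sqrt_divide)
  have nS: "(S *v x) \<bullet> (S *v x) = (\<Sum>j\<in>UNIV. (1 / p j) * ((transpose U *v x) $ j)\<^sup>2)
      + (x \<bullet> x - (transpose U *v x) \<bullet> (transpose U *v x))" for x
    using symmetric_matrix_inner[OF St, of x "S *v x"]
    by (simp add: matrix_vector_mul_assoc SS quadratic_column_scaling)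
  have nw: "(transpose U *v x) \<bullet> (transpose U *v x) = (\<Sum>j\<in>UNIV. ((transpose U *v x) $ j)\<^sup>2)" for x
    by (simp add: inner_vec_def power2_eq_square)
  have nS_le: "(S *v x) \<bullet> (S *v x) \<le> x \<bullet> x" for x
  proof -
    have "(\<Sum>j\<in>UNIV. (1 / p j) * ((transpose U *v x) $ j)\<^sup>2) \<le> (\<Sum>j\<in>UNIV. 1 * ((transpose U *v x) $ j)\<^sup>2)"
      by (intro sum_mono mult_right_mono p(2)) simp
    then show ?thesis by (simp add: nS nw)
  qed
  have nys: "(S *v x) \<bullet> (nystrom H \<Omega> *v (S *v x)) = (\<Sum>j\<in>UNIV. l j * (1 / p j) * ((transpose U *v x) $ j)\<^sup>2)" for x
  proof -
    have "transpose U *v (S *v x) = diagonal_matrix (\<lambda>j. sqrt (1 / p j)) *v (transpose U *v x)"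
      unfolding matrix_vector_mul_assoc S_def transpose_mult_column_scaling[OF U(1)] ..
    then have "((transpose U *v (S *v x)) $ j)\<^sup>2 = 1 / p j * ((transpose U *v x) $ j)\<^sup>2" for j
      using p(1)[of j] by (simp add: diagonal_matrix_mult_vec power_mult_distrib less_imp_le del: real_sqrt_divide)
    then show ?thesis unfolding U(3) quadratic_diagonal by (simp add: l_def)
  qed
  have main: "(S *v x) \<bullet> (nystrom H \<Omega> *v (S *v x)) + \<rho> * ((S *v x) \<bullet> (S *v x))
      = ls * ((transpose U *v x) \<bullet> (transpose U *v x)) + \<rho> * (x \<bullet> x)" for x
  proof -
    have "(\<Sum>j\<in>UNIV. l j * (1 / p j) * ((transpose U *v x) $ j)\<^sup>2)
        + \<rho> * (\<Sum>j\<in>UNIV. (1 / p j) * ((transpose U *v x) $ j)\<^sup>2)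
      = (\<Sum>j\<in>UNIV. ((l j + \<rho>) * (1 / p j)) * ((transpose U *v x) $ j)\<^sup>2)"
      by (simp add: sum_distrib_left sum.distrib[symmetric] algebra_simps add_divide_distrib)
    also have "\<dots> = (ls + \<rho>) * ((transpose U *v x) \<bullet> (transpose U *v x))"
      unfolding p(3) nw by (simp add: sum_distrib_left)
    finally show ?thesis unfolding nys nS by (simp add: algebra_simps)
  qed
  have lo: "\<rho> * (x \<bullet> x) \<le> x \<bullet> (A *v x)" for x
  proof -
    have "\<rho> * (x \<bullet> x) \<le> ls * ((transpose U *v x) \<bullet> (transpose U *v x)) + \<rho> * (x \<bullet> x)"
      using ls(1) by simp
    also have "\<dots> \<le> x \<bullet> (A *v x)"
      unfolding main[symmetric] quad using nystrom_between(2)[OF H] by simp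
    finally show ?thesis .
  qed
  have up: "x \<bullet> (A *v x) \<le> (ls + \<rho> + c) * (x \<bullet> x)" for x
  proof -
    have "x \<bullet> (A *v x) \<le> (ls * ((transpose U *v x) \<bullet> (transpose U *v x)) + \<rho> * (x \<bullet> x)) + c * ((S *v x) \<bullet> (S *v x))"
      unfolding main[symmetric] quad using err[of "S *v x"] by simp
    also have "\<dots> \<le> (ls * (x \<bullet> x) + \<rho> * (x \<bullet> x)) + c * (x \<bullet> x)"
      using norm_transpose_mult_le[OF U(1), of x] nS_le ls(1) c
      by (intro add_mono mult_left_mono order_refl) auto
    finally show ?thesis by (simp add: algebra_simps)
  qed
  show "1 \<le> cond2 A" "cond2 A \<le> (lam_s \<Lambda> + \<rho> + c) / \<rho>"
    using cond2_bounds[OF At rho lo up] by (auto simp: ls_def)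
qed

text \<open>The trace of \<open>D\<close> dominates its trace over the columns of \<open>U\<close>,
  and on each column the resolvent of \<open>H\<close> is at most
  \<open>1 / (ls + \<sigma>)\<close>.\<close>

lemma d_eff_ge:
  fixes H :: "real^'d^'d" and \<Omega> :: "real^'s^'d"
  assumes H: "sym_psd H" and sig: "0 < \<sigma>" and ne: "nystrom_eig H \<Omega> U \<Lambda>"
  shows "real CARD('s) * (lam_s \<Lambda> / (lam_s \<Lambda> + \<sigma>)) \<le> d_eff H \<sigma>"
proof -
  note U = nystrom_eig_diagonal[OF ne]
  define ls where "ls = lam_s \<Lambda>"
  have ls: "0 \<le> ls" using lam_s_nonneg[OF H ne] by (simp add: ls_def)
  obtain q h where q: "orthonormal_family q" and Hq: "H = spectral_matrix q h" and h: "\<And>i. 0 \<le> h i"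
    using sym_psd_spectral[OF H] by metis
  define g where "g i = 1 / (h i + \<sigma>)" for i
  have hs: "h i + \<sigma> > 0" for i using h[of i] sig by linarith
  have H_ge: "ls * ((transpose U *v y) \<bullet> (transpose U *v y)) \<le> y \<bullet> (H *v y)" for y
  proof -
    have "ls * ((transpose U *v y) \<bullet> (transpose U *v y)) = (\<Sum>j\<in>UNIV. ls * ((transpose U *v y) $ j)\<^sup>2)"
      by (simp add: inner_vec_def power2_eq_square sum_distrib_left)
    also have "\<dots> \<le> y \<bullet> (nystrom H \<Omega> *v y)"
      unfolding U(3) quadratic_diagonal using lam_s_le[of \<Lambda>]
      by (intro sum_mono mult_right_mono) (auto simp: ls_def)
    also have "\<dots> \<le> y \<bullet> (H *v y)" by (rule nystrom_between(2)[OF H])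
    finally show ?thesis .
  qed
  define u where "u j = U *v axis j 1" for j
  have uu: "u j \<bullet> u j = 1" for j
    by (simp add: u_def inner_matrix_vector_transpose[of _ U] matrix_vector_mul_assoc U inner_axis_axis)
  have inv_le: "u j \<bullet> (spectral_matrix q g *v u j) \<le> 1 / (ls + \<sigma>)" for j
  proof -
    \<comment> \<open>Antitonicity of the inverse by hand: \<open>y\<close> solves the regularised
      system for \<open>u j\<close>, and pairing it with \<open>u j\<close> gives
      \<open>w $ j \<ge> (ls + \<sigma>) * (w $ j)\<^sup>2\<close>.\<close>
    define y where "y = spectral_matrix q g *v u j"
    define w where "w = transpose U *v y"
    have "(H + \<sigma> *\<^sub>R mat 1) *v y = u j"
      using hs by (simp add: y_def Hq spectral_matrix_shift[OF q] matrix_vector_mul_assoc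
          spectral_matrix_mult[OF q] g_def less_imp_neq[symmetric] spectral_matrix_one[OF q])
    then have "u j \<bullet> y = y \<bullet> (H *v y) + \<sigma> * (y \<bullet> y)"
      by (metis inner_add_right inner_commute inner_scaleR_right matrix_vector_mul_lid
          matrix_vector_mult_add_rdistrib scaleR_matrix_vector_assoc)
    also have "\<dots> \<ge> (ls + \<sigma>) * (w \<bullet> w)"
      using H_ge[of y] mult_left_mono[OF norm_transpose_mult_le[OF U(1), of y] less_imp_le[OF sig]]
      unfolding w_def distrib_right by linarith
    finally have 1: "(ls + \<sigma>) * (w \<bullet> w) \<le> u j \<bullet> y" .
    have "u j \<bullet> y = y \<bullet> (U *v axis j 1)" by (simp add: u_def inner_commute)
    also have "\<dots> = w \<bullet> axis j 1" unfolding w_def by (rule inner_matrix_vector_transpose)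
    finally have uy: "u j \<bullet> y = w $ j" by (simp add: inner_axis)
    have "(w $ j)\<^sup>2 \<le> w \<bullet> w"
      unfolding inner_vec_def power2_eq_square
      using member_le_sum[of j UNIV "\<lambda>i. w $ i * w $ i"] by simp
    then have wj: "(ls + \<sigma>) * (w $ j)\<^sup>2 \<le> w $ j"
      using 1 ls sig unfolding uy by (smt (verit) mult_left_mono)
    have "w $ j \<le> 1 / (ls + \<sigma>)"
    proof (cases "0 < w $ j")
      case True
      have "((ls + \<sigma>) * w $ j) * w $ j \<le> 1 * w $ j"
        using wj by (simp add: power2_eq_square mult.assoc)
      then have "(ls + \<sigma>) * w $ j \<le> 1" using True by (simp only: mult_le_cancel_right_pos)
      then show ?thesis using ls sig by (simp add: pos_le_divide_eq mult.commute)
    next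
      case False
      moreover have "0 \<le> 1 / (ls + \<sigma>)" using ls sig by simp
      ultimately show ?thesis by linarith
    qed
    then show ?thesis unfolding y_def[symmetric] uy .
  qed
  have "ls / (ls + \<sigma>) = 1 - \<sigma> * (1 / (ls + \<sigma>))" using ls sig by (simp add: field_simps)
  then have "real CARD('s) * (ls / (ls + \<sigma>)) = (\<Sum>j\<in>(UNIV::'s set). 1 - \<sigma> * (1 / (ls + \<sigma>)))"
    by simp
  also have "\<dots> \<le> (\<Sum>j\<in>UNIV. u j \<bullet> u j - \<sigma> * (u j \<bullet> (spectral_matrix q g *v u j)))"
    unfolding uu using inv_le sig by (intro sum_mono diff_mono mult_left_mono) auto
  also have "\<dots> = (\<Sum>j\<in>UNIV. \<Sum>i\<in>UNIV. (h i / (h i + \<sigma>)) * (q i \<bullet> u j)\<^sup>2)"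
  proof (rule sum.cong[OF refl])
    fix j
    have eq: "h i / (h i + \<sigma>) = 1 - \<sigma> * g i" for i using hs[of i] by (simp add: g_def field_simps)
    show "u j \<bullet> u j - \<sigma> * (u j \<bullet> (spectral_matrix q g *v u j)) = (\<Sum>i\<in>UNIV. (h i / (h i + \<sigma>)) * (q i \<bullet> u j)\<^sup>2)"
      unfolding quadratic_spectral_matrix parseval[OF q, of "u j" "u j"] eq
      by (simp add: sum_distrib_left sum_subtractf algebra_simps power2_eq_square)
  qed
  also have "\<dots> = (\<Sum>i\<in>UNIV. (h i / (h i + \<sigma>)) * ((transpose U *v q i) \<bullet> (transpose U *v q i)))"
  proof (subst sum.swap, rule sum.cong[OF refl])
    fix i
    have "q i \<bullet> u j = (transpose U *v q i) $ j" for j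
      unfolding u_def inner_matrix_vector_transpose by (simp add: inner_axis)
    then show "(\<Sum>j\<in>UNIV. (h i / (h i + \<sigma>)) * (q i \<bullet> u j)\<^sup>2)
        = (h i / (h i + \<sigma>)) * ((transpose U *v q i) \<bullet> (transpose U *v q i))"
      unfolding inner_vec_def[of "transpose U *v q i"]
      by (simp only: sum_distrib_left power2_eq_square inner_real_def)
  qed
  \<comment> \<open>After exchanging the sums, Bessel's inequality bounds the weight of each
    eigenvector \<open>q i\<close> by 1.\<close>
  also have "\<dots> \<le> (\<Sum>i\<in>UNIV. (h i / (h i + \<sigma>)) * 1)"
  proof (intro sum_mono mult_left_mono)
    fix i
    show "(transpose U *v q i) \<bullet> (transpose U *v q i) \<le> 1"
      using norm_transpose_mult_le[OF U(1), of "q i"] q by (simp add: orthonormal_family_def)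
    show "0 \<le> h i / (h i + \<sigma>)" using h[of i] hs[of i] by simp
  qed
  also have "\<dots> = d_eff H \<sigma>" by (simp add: Hq d_eff_spectral_matrix[OF q h sig])
  finally show ?thesis by (simp add: ls_def)
qed

text \<open>A ratio \<open>lam_s \<Lambda> / (lam_s \<Lambda> + \<sigma>)\<close> of at most 1/8 is
  the same as \<open>lam_s \<Lambda> \<le> \<sigma> / 7\<close>; the factor 7 times the 6 in the
  regularisation yields 42.\<close>

lemma lam_s_le_of_d_eff:
  fixes H :: "real^'d^'d" and \<Omega> :: "real^'s^'d"
  assumes H: "sym_psd H" and sig: "0 < \<sigma>" and ne: "nystrom_eig H \<Omega> U \<Lambda>"
    and s: "8 * d_eff H \<sigma> \<le> real CARD('s)"
  shows "lam_s \<Lambda> \<le> \<sigma> / 7"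
proof -
  have ls: "0 \<le> lam_s \<Lambda>" by (rule lam_s_nonneg[OF H ne])
  define r where "r = lam_s \<Lambda> / (lam_s \<Lambda> + \<sigma>)"
  have "8 * (real CARD('s) * r) \<le> real CARD('s)"
    using d_eff_ge[OF H sig ne] s unfolding r_def by linarith
  then have "real CARD('s) * (8 * r) \<le> real CARD('s) * 1" by (simp add: mult.left_commute)
  then have "8 * r \<le> 1"
    by (simp only: mult_le_cancel_left_pos zero_less_card_finite of_nat_0_less_iff)
  then show ?thesis using ls sig unfolding r_def by (simp add: field_simps)
qed

section \<open>The standard Gaussian measure on a Euclidean space\<close>

definition gauss_density :: "'a::euclidean_space \<Rightarrow> real" where
  "gauss_density x = (\<Prod>b\<in>Basis. std_normal_density (x \<bullet> b))"

text \<open>This measure governs the auxiliary direction over which exponentials are averaged; the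
  randomness of \<open>\<Omega>\<close> lives on \<open>M\<close>.\<close>

definition gauss :: "'a::euclidean_space measure" where
  "gauss = density lborel (\<lambda>x. ennreal (gauss_density x))"

lemma gauss_density_nonneg: "0 \<le> gauss_density x"
  unfolding gauss_density_def by (intro prod_nonneg) simp

lemma borel_measurable_gauss_density [measurable]: "gauss_density \<in> borel_measurable borel"
  unfolding gauss_density_def by measurable

lemma sets_gauss [measurable_cong, simp]: "sets gauss = sets borel"
  by (simp add: gauss_def)

lemma space_gauss [simp]: "space gauss = UNIV"
  by (simp add: gauss_def)

lemma prob_space_gauss: "prob_space (gauss :: 'a::euclidean_space measure)"
proof (rule prob_spaceI)
  have one: "(\<integral>\<^sup>+x. ennreal (std_normal_density x) \<partial>lborel) = 1"
    using prob_space.emeasure_space_1[OF prob_space_normal_density[of 1 0]]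
    by (simp add: emeasure_density)
  have "emeasure (gauss :: 'a measure) (space gauss) = (\<integral>\<^sup>+x. (\<Prod>b\<in>Basis. ennreal (std_normal_density ((x::'a) \<bullet> b))) \<partial>lborel)"
    by (simp add: gauss_def emeasure_density gauss_density_def prod_ennreal)
  also have "\<dots> = (\<Prod>b\<in>(Basis :: 'a set). \<integral>\<^sup>+x. ennreal (std_normal_density x) \<partial>lborel)"
    by (rule nn_integral_lborel_prod) auto
  finally show "emeasure (gauss :: 'a measure) (space gauss) = 1" by (simp add: one)
qed

lemma gauss_density_shift:
  "gauss_density (x + \<xi>) = gauss_density \<xi> * exp (- (x \<bullet> \<xi>) - (x \<bullet> x) / 2)"
proof -
  have *: "std_normal_density (a + b) = std_normal_density b * exp (- (a * b) - a * a / 2)" for a b :: real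
    by (simp add: std_normal_density_def mult_exp_exp power2_eq_square field_simps)
  have "gauss_density (x + \<xi>) = (\<Prod>b\<in>Basis. std_normal_density (\<xi> \<bullet> b)
      * exp (- ((x \<bullet> b) * (\<xi> \<bullet> b)) - (x \<bullet> b) * (x \<bullet> b) / 2))"
    by (simp add: gauss_density_def inner_add_left *)
  also have "\<dots> = gauss_density \<xi> * exp (\<Sum>b\<in>Basis. - ((x \<bullet> b) * (\<xi> \<bullet> b)) - (x \<bullet> b) * (x \<bullet> b) / 2)"
    by (simp add: gauss_density_def prod.distrib exp_sum)
  also have "(\<Sum>b\<in>Basis. - ((x \<bullet> b) * (\<xi> \<bullet> b)) - (x \<bullet> b) * (x \<bullet> b) / 2) = - (x \<bullet> \<xi>) - (x \<bullet> x) / 2"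
    unfolding euclidean_inner[of x \<xi>] euclidean_inner[of x x]
    by (simp add: sum_subtractf sum_negf sum_divide_distrib)
  finally show ?thesis .
qed

text \<open>Cameron-Martin formula. The factor
  \<open>exp (- (x \<bullet> \<xi>) - (x \<bullet> x) / 2)\<close> is the price of moving the mean
  to \<open>x\<close>.\<close>

lemma nn_integral_gauss_shift:
  assumes [measurable]: "F \<in> borel_measurable borel"
  shows "(\<integral>\<^sup>+\<xi>. F \<xi> \<partial>gauss) = (\<integral>\<^sup>+\<xi>. F (x + \<xi>) * ennreal (exp (- (x \<bullet> \<xi>) - (x \<bullet> x) / 2)) \<partial>gauss)"
proof -
  have "(\<integral>\<^sup>+\<xi>. F \<xi> \<partial>gauss) = (\<integral>\<^sup>+\<xi>. ennreal (gauss_density \<xi>) * F \<xi> \<partial>lborel)"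
    unfolding gauss_def by (rule nn_integral_density) auto
  also have "\<dots> = (\<integral>\<^sup>+\<xi>. ennreal (gauss_density \<xi>) * F \<xi> \<partial>distr lborel borel ((+) x))"
    by (simp add: lborel_distr_plus)
  also have "\<dots> = (\<integral>\<^sup>+\<xi>. ennreal (gauss_density (x + \<xi>)) * F (x + \<xi>) \<partial>lborel)"
    by (rule nn_integral_distr) auto
  also have "\<dots> = (\<integral>\<^sup>+\<xi>. ennreal (gauss_density \<xi>) * (F (x + \<xi>) * ennreal (exp (- (x \<bullet> \<xi>) - (x \<bullet> x) / 2))) \<partial>lborel)"
    by (simp add: gauss_density_shift ennreal_mult gauss_density_nonneg mult_ac)
  also have "\<dots> = (\<integral>\<^sup>+\<xi>. F (x + \<xi>) * ennreal (exp (- (x \<bullet> \<xi>) - (x \<bullet> x) / 2)) \<partial>gauss)"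
    unfolding gauss_def by (rule nn_integral_density[symmetric]) auto
  finally show ?thesis .
qed

text \<open>Shifting by \<open>w\<close> itself cancels the linear terms in the exponent.\<close>

lemma gauss_mgf:
  fixes w :: "'a::euclidean_space"
  shows "(\<integral>\<^sup>+\<xi>. ennreal (exp (w \<bullet> \<xi>)) \<partial>gauss) = ennreal (exp ((w \<bullet> w) / 2))"
proof -
  have "(\<integral>\<^sup>+\<xi>. ennreal (exp (w \<bullet> \<xi>)) \<partial>gauss)
      = (\<integral>\<^sup>+\<xi>. ennreal (exp (w \<bullet> (w + \<xi>))) * ennreal (exp (- (w \<bullet> \<xi>) - (w \<bullet> w) / 2)) \<partial>gauss)"
    by (rule nn_integral_gauss_shift) simp
  also have "\<dots> = (\<integral>\<^sup>+\<xi>. ennreal (exp ((w \<bullet> w) / 2)) \<partial>(gauss :: 'a measure))"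
    by (intro nn_integral_cong) (simp add: ennreal_mult[symmetric] mult_exp_exp inner_add_right field_simps)
  also have "\<dots> = ennreal (exp ((w \<bullet> w) / 2))"
    using prob_space.emeasure_space_1[OF prob_space_gauss[where 'a = 'a]] by simp
  finally show ?thesis .
qed

lemma integrable_exp_inner_gauss: "integrable gauss (\<lambda>\<xi>. exp (w \<bullet> \<xi>))"
  by (rule integrableI_nonneg) (auto simp: gauss_mgf)

lemma integral_exp_inner_gauss: "(\<integral>\<xi>. exp (w \<bullet> \<xi>) \<partial>gauss) = exp ((w \<bullet> w) / 2)"
  by (rule integral_eq_nn_integral[THEN trans]) (auto simp: gauss_mgf)

text \<open>Lets second moments be dominated by exponential ones, which are known in closed form.
  The proof integrates a nonnegative second derivative twice.\<close>

lemma one_plus_half_square_le_cosh: "1 + z\<^sup>2 / 2 \<le> (exp z + exp (- z :: real)) / 2"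
proof -
  have "2 + 2 * (z\<^sup>2 / 2) \<le> exp z + exp (- z)" if "0 \<le> z" for z :: real
  proof -
    let ?f = "\<lambda>z. exp z + exp (- z) - z\<^sup>2"
    have d1: "(?f has_real_derivative exp x - exp (- x) - 2 * x) (at x)" for x
      by (auto intro!: derivative_eq_intros)
    have d2: "((\<lambda>x. exp x - exp (- x) - 2 * x) has_real_derivative exp x + exp (- x) - 2) (at x)" for x :: real
      by (auto intro!: derivative_eq_intros)
    have pos2: "exp x + exp (- x) - 2 \<ge> 0" for x :: real
    proof -
      have "0 \<le> (exp (x/2) - exp (-(x/2)))\<^sup>2" by simp
      also have "\<dots> = exp x + exp (- x) - 2"
        by (simp add: power2_diff mult_exp_exp exp_double[symmetric])
      finally show ?thesis .
    qed
    have pos1: "exp x - exp (- x) - 2 * x \<ge> 0" if "0 \<le> x" for x :: real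
      using DERIV_nonneg_imp_nondecreasing[OF that, of "\<lambda>x. exp x - exp (- x) - 2 * x"] d2 pos2 by fastforce
    have "?f 0 \<le> ?f z"
      by (rule DERIV_nonneg_imp_nondecreasing[OF that]) (use d1 pos1 in blast)
    then show ?thesis by simp
  qed
  from this[of "\<bar>z\<bar>"] show ?thesis by (cases "0 \<le> z") auto
qed

text \<open>The cosh bound with argument \<open>sqrt (2 * e)\<close> times
  \<open>w \<bullet> \<xi>\<close> gives \<open>1 + e * m \<le> exp (e * (w \<bullet> w))\<close>;
  letting \<open>e\<close> tend to 0 yields the variance bound.\<close>

lemma gauss_second_moment:
  shows integrable_inner_square_gauss: "integrable gauss (\<lambda>\<xi>. (w \<bullet> \<xi>)\<^sup>2)"
    and integral_inner_square_gauss_le: "(\<integral>\<xi>. (w \<bullet> \<xi>)\<^sup>2 \<partial>gauss) \<le> w \<bullet> w"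
proof -
  interpret G: prob_space "gauss :: 'a measure" by (rule prob_space_gauss)
  have dom: "integrable gauss (\<lambda>\<xi>. (exp ((r *\<^sub>R w) \<bullet> \<xi>) + exp ((- (r *\<^sub>R w)) \<bullet> \<xi>)) / 2)" for r
    using integrable_exp_inner_gauss[of "r *\<^sub>R w"] integrable_exp_inner_gauss[of "- (r *\<^sub>R w)"] by simp
  have bd: "1 + (r * (w \<bullet> \<xi>))\<^sup>2 / 2 \<le> (exp ((r *\<^sub>R w) \<bullet> \<xi>) + exp ((- (r *\<^sub>R w)) \<bullet> \<xi>)) / 2" for r \<xi>
    using one_plus_half_square_le_cosh[of "r * (w \<bullet> \<xi>)"] by simp
  show int: "integrable gauss (\<lambda>\<xi>. (w \<bullet> \<xi>)\<^sup>2)"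
  proof (rule Bochner_Integration.integrable_bound)
    show "integrable gauss (\<lambda>\<xi>. 2 * ((exp ((1 *\<^sub>R w) \<bullet> \<xi>) + exp ((- (1 *\<^sub>R w)) \<bullet> \<xi>)) / 2))"
      by (rule integrable_mult_right[OF dom])
    show "AE \<xi> in gauss. norm ((w \<bullet> \<xi>)\<^sup>2) \<le> norm (2 * ((exp ((1 *\<^sub>R w) \<bullet> \<xi>) + exp ((- (1 *\<^sub>R w)) \<bullet> \<xi>)) / 2))"
    proof (rule AE_I2)
      fix \<xi> :: 'a
      show "norm ((w \<bullet> \<xi>)\<^sup>2) \<le> norm (2 * ((exp ((1 *\<^sub>R w) \<bullet> \<xi>) + exp ((- (1 *\<^sub>R w)) \<bullet> \<xi>)) / 2))"
        using bd[of 1 \<xi>] by simp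
    qed
  qed simp
  define m where "m = (\<integral>\<xi>. (w \<bullet> \<xi>)\<^sup>2 \<partial>gauss)"
  have key: "m \<le> w \<bullet> w + e * (w \<bullet> w)\<^sup>2" if e: "0 < e" "e * (w \<bullet> w) \<le> 1" for e
  proof -
    define r where "r = sqrt (2 * e)"
    have r: "r\<^sup>2 = 2 * e" using e by (simp add: r_def)
    have "1 + e * m = (\<integral>\<xi>. 1 + (r * (w \<bullet> \<xi>))\<^sup>2 / 2 \<partial>gauss)"
      using int by (simp add: m_def power_mult_distrib r G.prob_space[simplified])
    also have "\<dots> \<le> (\<integral>\<xi>. (exp ((r *\<^sub>R w) \<bullet> \<xi>) + exp ((- (r *\<^sub>R w)) \<bullet> \<xi>)) / 2 \<partial>gauss)"
      by (rule integral_mono[OF _ dom bd]) (use int in \<open>simp add: power_mult_distrib\<close>)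
    also have "\<dots> = exp (e * (w \<bullet> w))"
    proof -
      have "(r *\<^sub>R w) \<bullet> (r *\<^sub>R w) / 2 = e * (w \<bullet> w)"
        using r by (simp add: power2_eq_square mult.assoc[symmetric])
      then have "(\<integral>\<xi>. exp ((r *\<^sub>R w) \<bullet> \<xi>) \<partial>gauss) = exp (e * (w \<bullet> w))"
        "(\<integral>\<xi>. exp ((- (r *\<^sub>R w)) \<bullet> \<xi>) \<partial>gauss) = exp (e * (w \<bullet> w))"
        unfolding integral_exp_inner_gauss by simp_all
      then show ?thesis
        using integrable_exp_inner_gauss[of "r *\<^sub>R w"] integrable_exp_inner_gauss[of "- (r *\<^sub>R w)"] by simp
    qed
    also have "\<dots> \<le> 1 + e * (w \<bullet> w) + (e * (w \<bullet> w))\<^sup>2"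
      using e by (intro exp_bound) auto
    finally have "e * m \<le> e * (w \<bullet> w + e * (w \<bullet> w)\<^sup>2)"
      by (simp add: power2_eq_square algebra_simps)
    then show ?thesis using e(1) by simp
  qed
  show "m \<le> w \<bullet> w"
  proof (rule ccontr)
    assume "\<not> m \<le> w \<bullet> w"
    define W where "W = w \<bullet> w"
    \<comment> \<open>Small enough for the quadratic bound on \<open>exp\<close>, and small enough
      that the remainder stays below the assumed gap \<open>m - W\<close>.\<close>
    define e where "e = min (1 / (W + 1)) ((m - W) / (W\<^sup>2 + 1))"
    have W: "0 \<le> W" "W < m" using \<open>\<not> m \<le> w \<bullet> w\<close> by (auto simp: W_def)
    have e: "0 < e" using W by (auto simp: e_def add_nonneg_pos)
    have "e * W \<le> 1 / (W + 1) * W" using W by (intro mult_right_mono) (auto simp: e_def)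
    also have "\<dots> \<le> 1" using W by simp
    finally have m_le: "m \<le> W + e * W\<^sup>2" using key[OF e] by (simp add: W_def)
    have D: "0 < W\<^sup>2 + 1" by (intro add_nonneg_pos) auto
    have "e * W\<^sup>2 < e * (W\<^sup>2 + 1)" using e by simp
    also have "\<dots> \<le> (m - W) / (W\<^sup>2 + 1) * (W\<^sup>2 + 1)"
      using D by (intro mult_right_mono) (auto simp: e_def)
    also have "\<dots> = m - W" using D by simp
    finally have "W + e * W\<^sup>2 < m" by simp
    with m_le show False by (metis not_le)
  qed
qed

lemma distr_gauss_uminus: "distr gauss borel uminus = (gauss :: 'a::euclidean_space measure)"
proof (rule measure_eqI)
  fix A :: "'a set" assume "A \<in> sets (distr gauss borel uminus)"
  then have A[measurable]: "A \<in> sets borel" by simp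
  have refl: "distr lborel borel (\<lambda>x. - x) = (lborel :: 'a measure)"
    using lborel_affine[of "-1" "0 :: 'a"] by (simp add: density_1)
  have sym: "gauss_density (- x) = gauss_density x" for x :: 'a
    by (simp add: gauss_density_def std_normal_density_def)
  have "emeasure (distr gauss borel uminus) A = (\<integral>\<^sup>+x. indicator A (- x) \<partial>(gauss :: 'a measure))"
    by (subst emeasure_distr) (auto simp: nn_integral_indicator[symmetric] indicator_def vimage_def simp del: nn_integral_indicator intro!: nn_integral_cong)
  also have "\<dots> = (\<integral>\<^sup>+x. ennreal (gauss_density (- x)) * indicator A (- x) \<partial>(lborel :: 'a measure))"
    unfolding gauss_def sym by (rule nn_integral_density) auto
  also have "\<dots> = (\<integral>\<^sup>+x. ennreal (gauss_density x) * indicator A x \<partial>distr lborel borel (\<lambda>x. - x))"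
    by (rule nn_integral_distr[symmetric]) auto
  also have "\<dots> = (\<integral>\<^sup>+x. indicator A x \<partial>gauss)"
    unfolding refl unfolding gauss_def by (rule nn_integral_density[symmetric]) auto
  finally show "emeasure (distr gauss borel uminus) A = emeasure gauss A" by simp
qed simp

text \<open>Square integrability gives integrability; reflection symmetry makes the mean equal its
  own negative.\<close>

lemma gauss_first_moment:
  shows integrable_inner_gauss: "integrable gauss (\<lambda>\<xi>. w \<bullet> \<xi>)"
    and integral_inner_gauss: "(\<integral>\<xi>. w \<bullet> \<xi> \<partial>gauss) = 0"
proof -
  interpret G: prob_space "gauss :: 'a measure" by (rule prob_space_gauss)
  show "integrable gauss (\<lambda>\<xi>. w \<bullet> \<xi>)"
    by (rule G.square_integrable_imp_integrable) (auto intro: integrable_inner_square_gauss)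
  have "(\<integral>\<xi>. w \<bullet> \<xi> \<partial>gauss) = (\<integral>\<xi>. w \<bullet> \<xi> \<partial>distr gauss borel uminus)"
    by (simp add: distr_gauss_uminus)
  also have "\<dots> = - (\<integral>\<xi>. w \<bullet> \<xi> \<partial>gauss)"
    by (subst integral_distr) auto
  finally show "(\<integral>\<xi>. w \<bullet> \<xi> \<partial>gauss) = 0" by simp
qed

text \<open>Jensen's inequality from the tangent of \<open>exp\<close> at the mean. The right side
  is a nonnegative integral, so \<open>exp\<close> of \<open>X\<close> may have infinite
  expectation.\<close>

lemma (in prob_space) exp_expectation_le:
  assumes X: "integrable M X"
  shows "ennreal (exp (expectation X)) \<le> (\<integral>\<^sup>+x. ennreal (exp (X x)) \<partial>M)"
proof -
  define m where "m = expectation X"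
  define Y where "Y x = exp m * (1 + (X x - m))" for x
  have Y: "integrable M Y" unfolding Y_def using X by (intro integrable_mult_right) auto
  have "exp m = expectation Y"
    unfolding Y_def using X by (simp add: m_def prob_space)
  also have "\<dots> \<le> expectation (\<lambda>x. max 0 (Y x))"
    using Y by (intro integral_mono) auto
  finally have "ennreal (exp m) \<le> ennreal (expectation (\<lambda>x. max 0 (Y x)))"
    by (rule ennreal_leI)
  also have "\<dots> = (\<integral>\<^sup>+x. ennreal (max 0 (Y x)) \<partial>M)"
    using Y by (intro nn_integral_eq_integral[symmetric]) auto
  also have "\<dots> \<le> (\<integral>\<^sup>+x. ennreal (exp (X x)) \<partial>M)"
  proof (intro nn_integral_mono ennreal_leI)
    fix x
    have "Y x \<le> exp m * exp (X x - m)"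
      unfolding Y_def by (intro mult_left_mono exp_ge_add_one_self) simp
    then show "max 0 (Y x) \<le> exp (X x)" by (simp add: mult_exp_exp)
  qed
  finally show ?thesis by (simp add: m_def)
qed

text \<open>The second derivative of \<open>ln (1 + y x\<^sup>2)\<close> is at least \<open>- y / 4\<close>, with equality at \<open>y x\<^sup>2 = 3\<close>.\<close>
lemma ln_one_plus_square_ge_tangent:
  fixes y m :: real
  assumes y: "0 < y"
  obtains k where "\<And>n. ln (1 + y * m\<^sup>2) + k * n - y / 8 * n\<^sup>2 \<le> ln (1 + y * (m + n)\<^sup>2)"
proof -
  \<comment> \<open>The added quadratic makes \<open>g\<close> convex, its second derivative being a
    multiple of a square; the claim is the tangent inequality of \<open>g\<close> at
    \<open>m\<close>.\<close>
  define g where "g x = ln (1 + y * x\<^sup>2) + y / 8 * x\<^sup>2" for x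
  define g' where "g' x = 2 * y * x / (1 + y * x\<^sup>2) + y / 4 * x" for x
  define g'' where "g'' x = 2 * y * (1 - y * x\<^sup>2) / (1 + y * x\<^sup>2)\<^sup>2 + y / 4" for x
  have pos: "0 < 1 + y * x\<^sup>2" for x using y by (simp add: add_pos_nonneg)
  then have ne: "1 + y * x\<^sup>2 \<noteq> 0" for x by (metis less_irrefl)
  have d1: "(g has_real_derivative g' x) (at x)" for x
    unfolding g_def[abs_def] g'_def using pos[of x]
    by (auto intro!: derivative_eq_intros simp: field_simps)
  have d2: "(g' has_real_derivative g'' x) (at x)" for x
    unfolding g'_def[abs_def] g''_def using ne[of x]
    by (auto intro!: derivative_eq_intros simp: field_simps power2_eq_square)
  have "0 \<le> g'' x" for x
  proof -
    have "g'' x = y / 4 * (3 - y * x\<^sup>2)\<^sup>2 / (1 + y * x\<^sup>2)\<^sup>2"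
      unfolding g''_def using ne[of x] by (simp add: divide_simps) (simp add: power2_eq_square algebra_simps)
    then show ?thesis using y by simp
  qed
  then have tan: "g' m * (x - m) \<le> g x - g m" for x
    by (intro f''_imp_f'[of UNIV g g' g'']) (use d1 d2 in auto)
  show thesis
  proof (rule that)
    fix n
    show "ln (1 + y * m\<^sup>2) + (g' m - y / 4 * m) * n - y / 8 * n\<^sup>2 \<le> ln (1 + y * (m + n)\<^sup>2)"
      using tan[of "m + n"] by (simp add: g_def power2_eq_square algebra_simps)
  qed
qed

section \<open>Laplace transform of a Gaussian matrix\<close>

text \<open>Tilting a centred normal density by \<open>exp (- \<mu> * x\<^sup>2)\<close> gives a
  multiple of another centred normal density, with variance divided by \<open>v\<close>. Negative
  \<open>\<mu>\<close> is allowed and serves the trace bound.\<close>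

lemma (in prob_space) normal_square_laplace:
  assumes Y: "distributed M lborel Y (normal_density 0 \<sigma>)" and sig: "0 < \<sigma>" and pos: "0 < 1 + 2 * \<mu> * \<sigma>\<^sup>2"
  shows "(\<integral>\<^sup>+\<omega>. ennreal (exp (- \<mu> * (Y \<omega>)\<^sup>2)) \<partial>M) = ennreal ((1 + 2 * \<mu> * \<sigma>\<^sup>2) powr (- 1 / 2))"
proof -
  define v where "v = 1 + 2 * \<mu> * \<sigma>\<^sup>2"
  define \<tau> where "\<tau> = \<sigma> / sqrt v"
  have v: "0 < v" using pos by (simp add: v_def)
  have tau: "0 < \<tau>" using sig v by (simp add: \<tau>_def)
  have eq: "normal_density 0 \<sigma> x * exp (- \<mu> * x\<^sup>2) = v powr (- 1 / 2) * normal_density 0 \<tau> x" for x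
  proof -
    have t2: "\<tau>\<^sup>2 = \<sigma>\<^sup>2 / v" using v by (simp add: \<tau>_def power_divide)
    have "- (x - 0)\<^sup>2 / (2 * \<sigma>\<^sup>2) + - \<mu> * x\<^sup>2 = - (x - 0)\<^sup>2 / (2 * \<tau>\<^sup>2)"
      using sig v by (simp add: t2 v_def field_simps)
    moreover have "1 / sqrt (2 * pi * \<sigma>\<^sup>2) = v powr (- 1 / 2) * (1 / sqrt (2 * pi * \<tau>\<^sup>2))"
      using sig v by (simp add: t2 powr_minus_divide powr_half_sqrt real_sqrt_divide real_sqrt_mult)
    ultimately show ?thesis
      unfolding normal_density_def by (simp add: mult_exp_exp)
  qed
  have one: "(\<integral>\<^sup>+x. ennreal (normal_density 0 \<tau> x) \<partial>lborel) = 1"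
    using prob_space.emeasure_space_1[OF prob_space_normal_density[OF tau, of 0]]
    by (simp add: emeasure_density)
  have "(\<integral>\<^sup>+\<omega>. ennreal (exp (- \<mu> * (Y \<omega>)\<^sup>2)) \<partial>M)
      = (\<integral>\<^sup>+x. ennreal (normal_density 0 \<sigma> x) * ennreal (exp (- \<mu> * x\<^sup>2)) \<partial>lborel)"
    by (rule distributed_nn_integral[OF Y, symmetric]) simp
  also have "\<dots> = (\<integral>\<^sup>+x. ennreal (v powr (- 1 / 2)) * ennreal (normal_density 0 \<tau> x) \<partial>lborel)"
    by (intro nn_integral_cong) (metis eq ennreal_mult exp_ge_zero normal_density_nonneg powr_ge_zero)
  also have "\<dots> = ennreal (v powr (- 1 / 2))"
    by (subst nn_integral_cmult) (auto simp: one)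
  finally show ?thesis by (simp add: v_def)
qed

lemma transpose_mult_inner_self:
  "(transpose (A :: real^'n^'m) *v \<theta>) \<bullet> (transpose A *v \<theta>) = (\<Sum>j\<in>UNIV. (\<Sum>i\<in>UNIV. \<theta> $ i * A $ i $ j)\<^sup>2)"
  by (simp add: inner_vec_def matrix_vector_mult_def transpose_def power2_eq_square mult.commute)

locale gaussian_matrix = prob_space M for M :: "'w measure" +
  fixes \<Omega> :: "'w \<Rightarrow> real^'s^'d"
  assumes indep: "indep_vars (\<lambda>_. borel) (\<lambda>(i, j) \<omega>. \<Omega> \<omega> $ i $ j) UNIV"
    and std: "\<And>i j. distributed M lborel (\<lambda>\<omega>. \<Omega> \<omega> $ i $ j) std_normal_density"
begin

lemma measurable_entry [measurable]: "(\<lambda>\<omega>. \<Omega> \<omega> $ i $ j) \<in> borel_measurable M"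
  using distributed_measurable[OF std[of i j]] by simp

lemma column_combination_distributed:
  assumes "\<theta> \<noteq> 0"
  shows "distributed M lborel (\<lambda>\<omega>. \<Sum>i\<in>UNIV. \<theta> $ i * \<Omega> \<omega> $ i $ j) (normal_density 0 (norm \<theta>))"
proof -
  \<comment> \<open>A zero coefficient would contribute a degenerate normal variable, which has no
    density.\<close>
  define I where "I = {i. \<theta> $ i \<noteq> 0}"
  have ne: "I \<noteq> {}" using assms by (auto simp: I_def vec_eq_iff)
  \<comment> \<open>Independence is indexed by pairs; grouping into singleton blocks extracts column
    \<open>j\<close>.\<close>
  have "indep_vars (\<lambda>i. PiM {(i, j)} (\<lambda>_. borel))
      (\<lambda>i \<omega>. restrict (\<lambda>p. (case p of (i, j) \<Rightarrow> \<lambda>\<omega>. \<Omega> \<omega> $ i $ j) \<omega>) {(i, j)}) UNIV"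
    by (rule indep_vars_restrict[OF indep]) (auto simp: disjoint_family_on_def)
  then have "indep_vars (\<lambda>_. borel)
      (\<lambda>i \<omega>. \<theta> $ i * restrict (\<lambda>p. (case p of (i, j) \<Rightarrow> \<lambda>\<omega>. \<Omega> \<omega> $ i $ j) \<omega>) {(i, j)} (i, j)) UNIV"
    by (rule indep_vars_compose2[where Y = "\<lambda>i f. \<theta> $ i * f (i, j)"])
       (auto intro!: borel_measurable_times measurable_component_singleton)
  then have "indep_vars (\<lambda>_. borel) (\<lambda>i \<omega>. \<theta> $ i * \<Omega> \<omega> $ i $ j) UNIV" by simp
  then have ind': "indep_vars (\<lambda>_. borel) (\<lambda>i \<omega>. \<theta> $ i * \<Omega> \<omega> $ i $ j) I"
    by (rule indep_vars_subset) simp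
  have "distributed M lborel (\<lambda>\<omega>. \<Sum>i\<in>I. \<theta> $ i * \<Omega> \<omega> $ i $ j)
      (normal_density (\<Sum>i\<in>I. 0) (sqrt (\<Sum>i\<in>I. \<bar>\<theta> $ i\<bar>\<^sup>2)))"
  proof (rule sum_indep_normal[OF _ ne ind'])
    fix i assume "i \<in> I"
    then show "distributed M lborel (\<lambda>\<omega>. \<theta> $ i * \<Omega> \<omega> $ i $ j) (normal_density 0 \<bar>\<theta> $ i\<bar>)"
      using normal_density_affine[OF std[of i j], of "\<theta> $ i" 0] by (simp add: I_def)
  qed (auto simp: I_def)
  also have "(\<lambda>\<omega>. \<Sum>i\<in>I. \<theta> $ i * \<Omega> \<omega> $ i $ j) = (\<lambda>\<omega>. \<Sum>i\<in>UNIV. \<theta> $ i * \<Omega> \<omega> $ i $ j)"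
    by (intro ext sum.mono_neutral_left) (auto simp: I_def)
  also have "(\<Sum>i\<in>I. \<bar>\<theta> $ i\<bar>\<^sup>2) = (\<Sum>i\<in>UNIV. (\<theta> $ i)\<^sup>2)"
    by (simp, intro sum.mono_neutral_left) (auto simp: I_def)
  also have "sqrt \<dots> = norm \<theta>"
    by (simp add: norm_vec_def L2_set_def)
  finally show ?thesis by simp
qed

text \<open>The coordinates of \<open>transpose (\<Omega> \<omega>) *v \<theta>\<close> are
  independent centred normals with variance \<open>\<theta> \<bullet> \<theta>\<close>, one per
  column, so the transform is a power of the scalar one.\<close>

lemma laplace:
  assumes pos: "0 < 1 + 2 * \<mu> * (\<theta> \<bullet> \<theta>)"
  shows "(\<integral>\<^sup>+\<omega>. ennreal (exp (- \<mu> * ((transpose (\<Omega> \<omega>) *v \<theta>) \<bullet> (transpose (\<Omega> \<omega>) *v \<theta>)))) \<partial>M)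
    = ennreal ((1 + 2 * \<mu> * (\<theta> \<bullet> \<theta>)) powr (- real CARD('s) / 2))"
proof -
  define Y where "Y j \<omega> = (\<Sum>i\<in>UNIV. \<theta> $ i * \<Omega> \<omega> $ i $ j)" for j \<omega>
  define v where "v = 1 + 2 * \<mu> * (\<theta> \<bullet> \<theta>)"
  have one: "(\<integral>\<^sup>+\<omega>. ennreal (exp (- \<mu> * (Y j \<omega>)\<^sup>2)) \<partial>M) = ennreal (v powr (- 1 / 2))" for j
  proof (cases "\<theta> = 0")
    case True
    then show ?thesis by (simp add: Y_def v_def emeasure_space_1)
  next
    case False
    then show ?thesis
      using normal_square_laplace[OF column_combination_distributed[OF False, of j], of \<mu>] pos
      by (simp add: Y_def v_def power2_norm_eq_inner)
  qed
  have "indep_vars (\<lambda>j. PiM (UNIV \<times> {j}) (\<lambda>_. borel))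
      (\<lambda>j \<omega>. restrict (\<lambda>p. (case p of (i, j) \<Rightarrow> \<lambda>\<omega>. \<Omega> \<omega> $ i $ j) \<omega>) (UNIV \<times> {j})) UNIV"
    by (rule indep_vars_restrict[OF indep]) (auto simp: disjoint_family_on_def)
  then have "indep_vars (\<lambda>_. borel) (\<lambda>j \<omega>. exp (- \<mu> * (\<Sum>i\<in>UNIV. \<theta> $ i *
      restrict (\<lambda>p. (case p of (i, j) \<Rightarrow> \<lambda>\<omega>. \<Omega> \<omega> $ i $ j) \<omega>) (UNIV \<times> {j}) (i, j))\<^sup>2)) UNIV"
    by (rule indep_vars_compose2[where Y = "\<lambda>j f. exp (- \<mu> * (\<Sum>i\<in>UNIV. \<theta> $ i * f (i, j))\<^sup>2)"])
       (auto intro!: borel_measurable_sum borel_measurable_times borel_measurable_power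
          measurable_compose[OF _ borel_measurable_exp] measurable_component_singleton)
  then have ind: "indep_vars (\<lambda>_. borel) (\<lambda>j \<omega>. exp (- \<mu> * (Y j \<omega>)\<^sup>2)) UNIV"
    by (simp add: Y_def)
  have ind': "indep_vars (\<lambda>_. borel) (\<lambda>j \<omega>. ennreal (exp (- \<mu> * (Y j \<omega>)\<^sup>2))) UNIV"
    using indep_vars_compose2[OF ind, of "\<lambda>_ x. ennreal x" "\<lambda>_. borel"] by simp
  have "(\<integral>\<^sup>+\<omega>. ennreal (exp (- \<mu> * ((transpose (\<Omega> \<omega>) *v \<theta>) \<bullet> (transpose (\<Omega> \<omega>) *v \<theta>)))) \<partial>M)
      = (\<integral>\<^sup>+\<omega>. (\<Prod>j\<in>UNIV. ennreal (exp (- \<mu> * (Y j \<omega>)\<^sup>2))) \<partial>M)"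
    by (simp add: transpose_mult_inner_self Y_def sum_distrib_left exp_sum[symmetric] prod_ennreal sum_negf)
  also have "\<dots> = (\<Prod>j\<in>(UNIV :: 's set). ennreal (v powr (- 1 / 2)))"
    by (subst indep_vars_nn_integral[OF _ ind']) (simp_all only: one finite zero_le)
  also have "\<dots> = ennreal (v powr (- real CARD('s) / 2))"
    using pos by (simp add: ennreal_power powr_power v_def)
  finally show ?thesis by (simp add: v_def)
qed

end

section \<open>A variational bound for vectors in the kernel\<close>

text \<open>The value 43/7 is \<open>1 + 2 * 3 * (6 / 7)\<close>, the argument of the logarithm in
  the kernel bound. The estimate is the 128th power of \<open>1 + x \<le> exp x\<close> at
  \<open>x = - (179 / 12800)\<close>.\<close>

lemma exp_179_100_le: "exp (179 / 100) \<le> (43 / 7 :: real)"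
proof -
  have "(1 - 179 / 12800) \<le> exp (- (179 / 12800 :: real))"
    using exp_ge_add_one_self[of "- (179 / 12800 :: real)"] by simp
  then have "(1 - 179 / 12800) ^ 128 \<le> exp (- (179 / 12800 :: real)) ^ 128"
    by (rule power_mono) simp
  also have "\<dots> = exp (- (179 / 100))" by (simp add: exp_of_nat_mult[symmetric])
  finally have "7 / 43 \<le> exp (- (179 / 100 :: real))" by (rule order_trans[rotated]) (simp add: power_divide)
  then show ?thesis by (simp add: exp_minus field_simps)
qed

text \<open>The numerical contradiction at the end of the kernel argument: with \<open>s\<close>
  this large, the exponent from the shifted Gaussian exceeds the logarithm \<open>l\<close> of the
  Markov threshold.\<close>

lemma sketch_size_margin:
  fixes s t l :: real
  assumes s: "100 \<le> s" and t: "0 \<le> t" and l: "0 \<le> l" and sum: "sqrt (8 * t) + sqrt (64 * l) \<le> sqrt s"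
  shows "l < - 7 * s / 16 + s / 2 * (179 / 100) - 3 / 7 - 24 / 7 * (40 * t * l / s + 20 / 19 * t)"
proof -
  define P Q where "P = sqrt (8 * t)" and "Q = sqrt (64 * l)"
  have P: "0 \<le> P" "t = P\<^sup>2 / 8" and Q: "0 \<le> Q" "l = Q\<^sup>2 / 64"
    using t l by (simp_all add: P_def Q_def)
  have PQ: "(P + Q)\<^sup>2 \<le> s"
    using power_mono[OF sum, of 2] s P(1) Q(1) by (simp add: P_def Q_def)
  \<comment> \<open>The mixed term is quartic in \<open>P\<close> and \<open>Q\<close> over
    \<open>s\<close>; this reduces it to a quadratic one.\<close>
  have "P * Q \<le> (P + Q)\<^sup>2" using P(1) Q(1) by (simp add: power2_sum)
  then have "(P * Q) * (P * Q) \<le> s * (P * Q)"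
    using PQ P(1) Q(1) by (intro mult_right_mono) auto
  then have "(P * Q) * (P * Q) / s \<le> P * Q" using s by (simp add: field_simps)
  then have "40 / 512 * ((P * Q) * (P * Q) / s) \<le> 40 / 512 * (P * Q)"
    by (intro mult_left_mono) auto
  also have "40 / 512 * ((P * Q) * (P * Q) / s) = 40 * t * l / s"
    by (simp add: P(2) Q(2) power2_eq_square mult_ac)
  finally have tl: "40 * t * l / s \<le> 40 / 512 * (P * Q)" .
  have "l + 24 / 7 * (40 * t * l / s + 20 / 19 * t) \<le> Q\<^sup>2 / 64 + 24 / 7 * (40 / 512 * (P * Q) + 20 / 19 * (P\<^sup>2 / 8))"
    using tl unfolding Q(2)[symmetric] P(2)[symmetric] by simp
  \<comment> \<open>The coefficient of \<open>P\<^sup>2\<close> is 60/133, just below 452/1000; the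
    other two have ample room.\<close>
  also have "\<dots> \<le> 452 / 1000 * (P\<^sup>2 + Q\<^sup>2 + 2 * P * Q)"
  proof -
    have "Y / 64 + 24 / 7 * (40 / 512 * Z + 20 / 19 * (X / 8)) \<le> 452 / 1000 * (X + Y + 2 * Z)"
      if "0 \<le> X" "0 \<le> Y" "0 \<le> Z" for X Y Z :: real
      using that by (simp add: field_simps)
    from this[of "P\<^sup>2" "Q\<^sup>2" "P * Q"] show ?thesis using P(1) Q(1) by simp
  qed
  also have "\<dots> \<le> 452 / 1000 * s" using PQ by (simp add: power2_sum)
  finally have "l + 24 / 7 * (40 * t * l / s + 20 / 19 * t) \<le> 452 / 1000 * s" .
  \<comment> \<open>The linear coefficient on the right is 0.4575, and \<open>100 \<le> s\<close>
    pays for the constant 3/7.\<close>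
  moreover have "452 / 1000 * s < - 7 * s / 16 + s / 2 * (179 / 100) - 3 / 7" using s by simp
  ultimately show ?thesis by linarith
qed

lemma exp_weighted_sum_le:
  fixes w z :: "'n::finite \<Rightarrow> real"
  assumes w: "\<And>i. 0 \<le> w i" "sum w UNIV = 1"
  shows "exp (\<Sum>i\<in>UNIV. w i * z i) \<le> (\<Sum>i\<in>UNIV. w i * exp (z i))"
proof -
  define m where "m = (\<Sum>i\<in>UNIV. w i * z i)"
  have "exp m = (\<Sum>i\<in>UNIV. w i * (exp m * (1 + (z i - m))))"
    using w(2) by (simp add: algebra_simps sum.distrib sum_subtractf sum_distrib_left[symmetric] sum_distrib_right[symmetric] m_def[symmetric])
  also have "\<dots> \<le> (\<Sum>i\<in>UNIV. w i * exp (z i))"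
  proof (intro sum_mono mult_left_mono w(1))
    fix i
    have "exp m * (1 + (z i - m)) \<le> exp m * exp (z i - m)"
      by (intro mult_left_mono exp_ge_add_one_self) simp
    then show "exp m * (1 + (z i - m)) \<le> exp (z i)" by (simp add: mult_exp_exp)
  qed
  finally show ?thesis by (simp add: m_def)
qed

section \<open>Gaussian averages of the exponential, and the two exceptional events\<close>

context gaussian_matrix
begin

text \<open>The mixture variable: the logarithmic term normalises each exponential by its Laplace
  transform, and the direction \<open>B *v \<xi>\<close> is Gaussian with covariance
  \<open>B ** transpose B\<close>.\<close>

definition smoothed :: "real \<Rightarrow> real^'d^'d \<Rightarrow> 'w \<Rightarrow> ennreal" where
  "smoothed \<mu> B \<omega> = (\<integral>\<^sup>+\<xi>. ennreal (exp (- \<mu> * ((transpose (\<Omega> \<omega>) *v (B *v \<xi>)) \<bullet> (transpose (\<Omega> \<omega>) *v (B *v \<xi>)))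
      + real CARD('s) / 2 * ln (1 + 2 * \<mu> * ((B *v \<xi>) \<bullet> (B *v \<xi>))))) \<partial>gauss)"

lemma measurable_mult_vec_nth [measurable]:
  "(\<lambda>\<xi>. (B *v \<xi>) $ i) \<in> borel_measurable borel" for B :: "real^'d^'d"
  by (intro borel_measurable_continuous_onI continuous_intros linear_continuous_on
      matrix_vector_mul_bounded_linear)

lemma measurable_mult_vec [measurable]:
  "(\<lambda>\<xi>. B *v \<xi>) \<in> borel_measurable borel" for B :: "real^'d^'d"
  by (intro borel_measurable_continuous_onI linear_continuous_on matrix_vector_mul_bounded_linear)

text \<open>By Tonelli the expectation over \<open>M\<close> can be taken first, and
  \<open>laplace\<close> makes it 1 for every \<open>\<xi>\<close>.\<close>

lemma smoothed_integral:
  shows measurable_smoothed: "smoothed \<mu> B \<in> borel_measurable M"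
    and nn_integral_smoothed: "0 < \<mu> \<Longrightarrow> (\<integral>\<^sup>+\<omega>. smoothed \<mu> B \<omega> \<partial>M) = 1"
proof -
  interpret G: prob_space "gauss :: (real^'d) measure" by (rule prob_space_gauss)
  interpret MG: pair_sigma_finite M "gauss :: (real^'d) measure" ..
  let ?f = "\<lambda>\<omega> \<xi>. ennreal (exp (- \<mu> * ((transpose (\<Omega> \<omega>) *v (B *v \<xi>)) \<bullet> (transpose (\<Omega> \<omega>) *v (B *v \<xi>)))
      + real CARD('s) / 2 * ln (1 + 2 * \<mu> * ((B *v \<xi>) \<bullet> (B *v \<xi>)))))"
  have meas: "(\<lambda>(\<omega>, \<xi>). ?f \<omega> \<xi>) \<in> borel_measurable (M \<Otimes>\<^sub>M gauss)"
    unfolding transpose_mult_inner_self by measurable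
  then show "smoothed \<mu> B \<in> borel_measurable M"
    unfolding smoothed_def[abs_def] by (rule G.borel_measurable_nn_integral)
  assume mu: "0 < \<mu>"
  have "(\<integral>\<^sup>+\<omega>. smoothed \<mu> B \<omega> \<partial>M) = (\<integral>\<^sup>+\<xi>. \<integral>\<^sup>+\<omega>. ?f \<omega> \<xi> \<partial>M \<partial>gauss)"
    unfolding smoothed_def by (rule MG.Fubini'[OF meas, symmetric])
  also have "\<dots> = (\<integral>\<^sup>+\<xi>. 1 \<partial>(gauss :: (real^'d) measure))"
  proof (rule nn_integral_cong)
    fix \<xi> :: "real^'d"
    let ?\<theta> = "B *v \<xi>"
    have pos: "0 < 1 + 2 * \<mu> * (?\<theta> \<bullet> ?\<theta>)" using mu by (simp add: add_pos_nonneg)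
    have [measurable]: "(\<lambda>\<omega>. ennreal (exp (- \<mu> * ((transpose (\<Omega> \<omega>) *v ?\<theta>) \<bullet> (transpose (\<Omega> \<omega>) *v ?\<theta>))))) \<in> borel_measurable M"
      unfolding transpose_mult_inner_self by measurable
    have "(\<integral>\<^sup>+\<omega>. ?f \<omega> \<xi> \<partial>M) = (\<integral>\<^sup>+\<omega>. ennreal ((1 + 2 * \<mu> * (?\<theta> \<bullet> ?\<theta>)) powr (real CARD('s) / 2)) *
        ennreal (exp (- \<mu> * ((transpose (\<Omega> \<omega>) *v ?\<theta>) \<bullet> (transpose (\<Omega> \<omega>) *v ?\<theta>)))) \<partial>M)"
      using pos by (intro nn_integral_cong) (simp add: ennreal_mult[symmetric] powr_def mult_exp_exp add.commute)
    also have "\<dots> = ennreal ((1 + 2 * \<mu> * (?\<theta> \<bullet> ?\<theta>)) powr (real CARD('s) / 2)) *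
        ennreal ((1 + 2 * \<mu> * (?\<theta> \<bullet> ?\<theta>)) powr (- real CARD('s) / 2))"
      by (subst nn_integral_cmult) (simp_all only: laplace[OF pos], measurable)
    also have "\<dots> = 1"
      using pos by (simp add: ennreal_mult[symmetric] powr_add[symmetric])
    finally show "(\<integral>\<^sup>+\<omega>. ?f \<omega> \<xi> \<partial>M) = 1" .
  qed
  also have "\<dots> = 1" using G.emeasure_space_1 by simp
  finally show "(\<integral>\<^sup>+\<omega>. smoothed \<mu> B \<omega> \<partial>M) = 1" .
qed

text \<open>Shift the Gaussian by \<open>x\<close> and apply Jensen; the kernel vector \<open>B x\<close> does not contribute to
  the term with \<open>\<Omega>\<close>, only to the logarithm.\<close>
lemma smoothed_ge:
  fixes B :: "real^'d^'d" and x :: "real^'d"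
  assumes sym: "transpose B = B" and mu: "0 < \<mu>"
    and ker: "transpose (\<Omega> \<omega>) *v (B *v x) = 0" and v0: "B *v x \<noteq> 0"
  defines "v \<equiv> B *v x"
  shows "ennreal (exp (- (x \<bullet> x) / 2
      + real CARD('s) / 2 * (ln (1 + 2 * \<mu> * (v \<bullet> v)) - \<mu> / 4 * ((B *v v) \<bullet> (B *v v) / (v \<bullet> v)))
      - \<mu> * (\<Sum>j\<in>UNIV. (B *v column j (\<Omega> \<omega>)) \<bullet> (B *v column j (\<Omega> \<omega>))))) \<le> smoothed \<mu> B \<omega>"
proof -
  interpret G: prob_space "gauss :: (real^'d) measure" by (rule prob_space_gauss)
  define s where "s = real CARD('s)"
  define c where "c j = column j (\<Omega> \<omega>)" for j
  define u where "u = (1 / norm v) *\<^sub>R v"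
  have v: "v \<noteq> 0" using v0 by (simp add: v_def)
  have u1: "norm u = 1" using v by (simp add: u_def)
  have uv: "u \<bullet> v = norm v" using v by (simp add: u_def power2_norm_eq_inner[symmetric] power2_eq_square)
  obtain k where k: "\<And>n. ln (1 + 2 * \<mu> * (norm v)\<^sup>2) + k * n - 2 * \<mu> / 8 * n\<^sup>2 \<le> ln (1 + 2 * \<mu> * (norm v + n)\<^sup>2)"
    using ln_one_plus_square_ge_tangent[of "2 * \<mu>" "norm v"] mu by auto
  have s0: "0 \<le> s" by (simp add: s_def)
  define a where "a = - (x \<bullet> x) / 2 + s / 2 * ln (1 + 2 * \<mu> * (v \<bullet> v))"
  define w where "w = (s / 2 * k) *\<^sub>R (B *v u) - x"
  \<comment> \<open>A lower bound for the shifted exponent including the Cameron-Martin factor. It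
    is affine plus quadratic in \<open>\<xi>\<close>, so its mean needs only first and second
    moments.\<close>
  define X where "X \<xi> = a + w \<bullet> \<xi> - \<mu> * (\<Sum>j\<in>UNIV. ((B *v c j) \<bullet> \<xi>)\<^sup>2) - s / 2 * (\<mu> / 4) * ((B *v u) \<bullet> \<xi>)\<^sup>2" for \<xi>
  have int: "integrable gauss X"
    unfolding X_def
    by (intro Bochner_Integration.integrable_diff Bochner_Integration.integrable_add integrable_mult_right
        Bochner_Integration.integrable_sum integrable_inner_gauss integrable_inner_square_gauss G.integrable_const)
  have "a - \<mu> * (\<Sum>j\<in>UNIV. (B *v c j) \<bullet> (B *v c j)) - s / 2 * (\<mu> / 4) * ((B *v u) \<bullet> (B *v u))
    \<le> a - \<mu> * (\<Sum>j\<in>UNIV. G.expectation (\<lambda>\<xi>. ((B *v c j) \<bullet> \<xi>)\<^sup>2)) - s / 2 * (\<mu> / 4) * G.expectation (\<lambda>\<xi>. ((B *v u) \<bullet> \<xi>)\<^sup>2)"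
    using mu s0 by (intro diff_mono mult_left_mono sum_mono integral_inner_square_gauss_le) auto
  also have "\<dots> = G.expectation X"
    unfolding X_def[abs_def] using G.prob_space
    by (simp add: integrable_inner_gauss integrable_inner_square_gauss integral_inner_gauss)
  finally have EX: "a - \<mu> * (\<Sum>j\<in>UNIV. (B *v c j) \<bullet> (B *v c j)) - s / 2 * (\<mu> / 4) * ((B *v u) \<bullet> (B *v u)) \<le> G.expectation X" .
  have Bu: "(B *v u) \<bullet> (B *v u) = (B *v v) \<bullet> (B *v v) / (v \<bullet> v)"
    unfolding u_def matrix_vector_mult_scaleR by (simp add: power2_norm_eq_inner[symmetric] power2_eq_square)
  have eq: "a - \<mu> * (\<Sum>j\<in>UNIV. (B *v c j) \<bullet> (B *v c j)) - s / 2 * (\<mu> / 4) * ((B *v u) \<bullet> (B *v u))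
    = - (x \<bullet> x) / 2 + s / 2 * (ln (1 + 2 * \<mu> * (v \<bullet> v)) - \<mu> / 4 * ((B *v v) \<bullet> (B *v v) / (v \<bullet> v)))
      - \<mu> * (\<Sum>j\<in>UNIV. (B *v c j) \<bullet> (B *v c j))"
    unfolding Bu a_def by (simp add: algebra_simps)
  let ?Z = "\<lambda>\<xi>. - \<mu> * ((transpose (\<Omega> \<omega>) *v (B *v \<xi>)) \<bullet> (transpose (\<Omega> \<omega>) *v (B *v \<xi>)))
      + s / 2 * ln (1 + 2 * \<mu> * ((B *v \<xi>) \<bullet> (B *v \<xi>)))"
  have "ennreal (exp (a - \<mu> * (\<Sum>j\<in>UNIV. (B *v c j) \<bullet> (B *v c j)) - s / 2 * (\<mu> / 4) * ((B *v u) \<bullet> (B *v u))))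
      \<le> ennreal (exp (G.expectation X))"
    using EX by (intro ennreal_leI) simp
  also have "\<dots> \<le> (\<integral>\<^sup>+\<xi>. ennreal (exp (X \<xi>)) \<partial>gauss)" by (rule G.exp_expectation_le[OF int])
  also have "\<dots> \<le> (\<integral>\<^sup>+\<xi>. ennreal (exp (?Z (x + \<xi>))) * ennreal (exp (- (x \<bullet> \<xi>) - (x \<bullet> x) / 2)) \<partial>gauss)"
  proof (intro nn_integral_mono)
    fix \<xi> :: "real^'d"
    define n where "n = (B *v u) \<bullet> \<xi>"
    have "u \<bullet> (B *v \<xi>) = n" unfolding n_def by (rule symmetric_matrix_inner[OF sym])
    then have "norm v + n = u \<bullet> (B *v (x + \<xi>))"
      by (simp add: matrix_vector_right_distrib inner_add_right v_def[symmetric] uv)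
    \<comment> \<open>Projecting onto the unit vector \<open>u\<close> reduces the logarithm to one
      real variable, where the tangent bound at \<open>norm v\<close> applies.\<close>
    then have "(norm v + n)\<^sup>2 \<le> (u \<bullet> u) * ((B *v (x + \<xi>)) \<bullet> (B *v (x + \<xi>)))"
      using Cauchy_Schwarz_ineq[of u "B *v (x + \<xi>)"] by simp
    then have "(norm v + n)\<^sup>2 \<le> (B *v (x + \<xi>)) \<bullet> (B *v (x + \<xi>))"
      using u1 by (simp add: norm_eq_1)
    then have "1 + 2 * \<mu> * (norm v + n)\<^sup>2 \<le> 1 + 2 * \<mu> * ((B *v (x + \<xi>)) \<bullet> (B *v (x + \<xi>)))"
      using mu by simp
    then have "ln (1 + 2 * \<mu> * (norm v + n)\<^sup>2) \<le> ln (1 + 2 * \<mu> * ((B *v (x + \<xi>)) \<bullet> (B *v (x + \<xi>))))"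
      using mu by (intro ln_mono) (auto intro!: add_pos_nonneg)
    with k[of n] have "ln (1 + 2 * \<mu> * (norm v)\<^sup>2) + k * n - 2 * \<mu> / 8 * n\<^sup>2 \<le> ln (1 + 2 * \<mu> * ((B *v (x + \<xi>)) \<bullet> (B *v (x + \<xi>))))"
      by linarith
    from mult_left_mono[OF this, of "s / 2"] s0
    have L: "s / 2 * (ln (1 + 2 * \<mu> * (v \<bullet> v)) + k * n - \<mu> / 4 * n\<^sup>2)
      \<le> s / 2 * ln (1 + 2 * \<mu> * ((B *v (x + \<xi>)) \<bullet> (B *v (x + \<xi>))))"
      by (simp add: power2_norm_eq_inner)
    have comp: "(transpose (\<Omega> \<omega>) *v (B *v (x + \<xi>))) $ j = (B *v c j) \<bullet> \<xi>" for j
    proof -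
      have "transpose (\<Omega> \<omega>) *v (B *v (x + \<xi>)) = transpose (\<Omega> \<omega>) *v (B *v \<xi>)"
        by (simp add: matrix_vector_right_distrib ker)
      moreover have "(transpose (\<Omega> \<omega>) *v (B *v \<xi>)) $ j = c j \<bullet> (B *v \<xi>)"
        by (simp add: matrix_vector_mult_def transpose_def inner_vec_def c_def column_def)
      ultimately show ?thesis using symmetric_matrix_inner[OF sym, of "c j" \<xi>] by simp
    qed
    have Q: "(transpose (\<Omega> \<omega>) *v (B *v (x + \<xi>))) \<bullet> (transpose (\<Omega> \<omega>) *v (B *v (x + \<xi>)))
        = (\<Sum>j\<in>UNIV. ((B *v c j) \<bullet> \<xi>)\<^sup>2)"
      by (subst inner_vec_def) (simp add: comp power2_eq_square)
    have "X \<xi> = - \<mu> * (\<Sum>j\<in>UNIV. ((B *v c j) \<bullet> \<xi>)\<^sup>2) + s / 2 * (ln (1 + 2 * \<mu> * (v \<bullet> v)) + k * n - \<mu> / 4 * n\<^sup>2)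
        + (- (x \<bullet> \<xi>) - (x \<bullet> x) / 2)"
      by (simp add: X_def a_def w_def n_def inner_diff_left algebra_simps)
    also have "\<dots> \<le> ?Z (x + \<xi>) + (- (x \<bullet> \<xi>) - (x \<bullet> x) / 2)"
      unfolding Q using L by (intro add_mono order_refl)
    finally have "exp (X \<xi>) \<le> exp (?Z (x + \<xi>)) * exp (- (x \<bullet> \<xi>) - (x \<bullet> x) / 2)"
      by (simp add: mult_exp_exp)
    then show "ennreal (exp (X \<xi>)) \<le> ennreal (exp (?Z (x + \<xi>))) * ennreal (exp (- (x \<bullet> \<xi>) - (x \<bullet> x) / 2))"
      by (simp add: ennreal_mult[symmetric])
  qed
  also have "\<dots> = smoothed \<mu> B \<omega>"
  proof -
    have "(\<lambda>\<xi>. ennreal (exp (?Z \<xi>))) \<in> borel_measurable borel"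
      unfolding transpose_mult_inner_self by measurable
    from nn_integral_gauss_shift[OF this, of x] show ?thesis
      unfolding smoothed_def s_def by simp
  qed
  finally show ?thesis unfolding eq by (simp only: s_def c_def)
qed

text \<open>Averaging exponentials instead of exponentiating the average needs only one Laplace
  transform per vector and no joint law. Total weight at most 1 also covers the weights
  \<open>d i / t\<close> when \<open>t = 0\<close>.\<close>

lemma trace_exp_moment_le:
  fixes q :: "'d \<Rightarrow> real^'d" and w :: "'d \<Rightarrow> real"
  assumes q: "\<And>i. q i \<bullet> q i = 1" and w: "\<And>i. 0 \<le> w i" "sum w UNIV \<le> 1" and \<nu>: "\<nu> < 1 / 2"
  shows "(\<integral>\<^sup>+\<omega>. ennreal (\<Sum>i\<in>UNIV. w i * exp (\<nu> * ((transpose (\<Omega> \<omega>) *v q i) \<bullet> (transpose (\<Omega> \<omega>) *v q i)))) \<partial>M)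
    \<le> ennreal ((1 - 2 * \<nu>) powr (- real CARD('s) / 2))"
proof -
  let ?N = "\<lambda>\<omega> i. (transpose (\<Omega> \<omega>) *v q i) \<bullet> (transpose (\<Omega> \<omega>) *v q i)"
  have [measurable]: "(\<lambda>\<omega>. ?N \<omega> i) \<in> borel_measurable M" for i
    unfolding transpose_mult_inner_self by measurable
  have "(\<integral>\<^sup>+\<omega>. ennreal (\<Sum>i\<in>UNIV. w i * exp (\<nu> * ?N \<omega> i)) \<partial>M)
      = (\<integral>\<^sup>+\<omega>. (\<Sum>i\<in>UNIV. ennreal (w i) * ennreal (exp (\<nu> * ?N \<omega> i))) \<partial>M)"
    using w(1) by (intro nn_integral_cong) (simp add: sum_ennreal[symmetric] ennreal_mult)
  also have "\<dots> = (\<Sum>i\<in>UNIV. ennreal (w i) * (\<integral>\<^sup>+\<omega>. ennreal (exp (\<nu> * ?N \<omega> i)) \<partial>M))"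
    by (subst nn_integral_sum) (auto simp: nn_integral_cmult)
  also have "\<dots> = (\<Sum>i\<in>UNIV. ennreal (w i) * ennreal ((1 - 2 * \<nu>) powr (- real CARD('s) / 2)))"
    using laplace[of "- \<nu>" "q _"] \<nu> by (simp add: q)
  also have "\<dots> = ennreal (sum w UNIV * (1 - 2 * \<nu>) powr (- real CARD('s) / 2))"
    using w(1) by (simp add: ennreal_mult[symmetric] sum_ennreal sum_distrib_right)
  also have "\<dots> \<le> ennreal ((1 - 2 * \<nu>) powr (- real CARD('s) / 2))"
    using w(2) by (intro ennreal_leI) (simp add: mult_left_le_one_le sum_nonneg w(1))
  finally show ?thesis .
qed

text \<open>Each of the two exceptional events receives half of the failure probability.\<close>

lemma markov_event:
  assumes [measurable]: "f \<in> borel_measurable M" and int: "(\<integral>\<^sup>+\<omega>. f \<omega> \<partial>M) \<le> ennreal c"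
    and c: "0 < c" and \<delta>: "0 < \<delta>"
  shows "prob {\<omega> \<in> space M. ennreal (c * (2 / \<delta>)) \<le> f \<omega>} \<le> \<delta> / 2"
proof -
  let ?k = "\<delta> / (2 * c)"
  have k: "0 < ?k" using c \<delta> by simp
  have one: "1 \<le> ennreal ?k * f \<omega>" if "ennreal (c * (2 / \<delta>)) \<le> f \<omega>" for \<omega>
  proof -
    have "1 = ennreal ?k * ennreal (c * (2 / \<delta>))"
      using c \<delta> by (simp add: ennreal_mult[symmetric])
    also have "\<dots> \<le> ennreal ?k * f \<omega>" using that by (rule mult_left_mono) simp
    finally show ?thesis .
  qed
  have "emeasure M {\<omega> \<in> space M. ennreal (c * (2 / \<delta>)) \<le> f \<omega>} \<le> emeasure M {\<omega> \<in> space M. 1 \<le> ennreal ?k * f \<omega>}"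
    using one by (intro emeasure_mono) auto
  also have "\<dots> \<le> ennreal ?k * (\<integral>\<^sup>+\<omega>. f \<omega> * indicator (space M) \<omega> \<partial>M)"
    by (rule nn_integral_Markov_inequality) auto
  also have "(\<integral>\<^sup>+\<omega>. f \<omega> * indicator (space M) \<omega> \<partial>M) = (\<integral>\<^sup>+\<omega>. f \<omega> \<partial>M)"
    by (intro nn_integral_cong) simp
  also have "ennreal ?k * (\<integral>\<^sup>+\<omega>. f \<omega> \<partial>M) \<le> ennreal ?k * ennreal c"
    using int by (rule mult_left_mono) simp
  also have "\<dots> = ennreal (\<delta> / 2)" using c \<delta> by (simp add: ennreal_mult[symmetric])
  finally show ?thesis using \<delta> by (simp add: emeasure_eq_measure)
qed

text \<open>With \<open>s\<close> columns, the prior variance \<open>1/\<beta>\<close>, \<open>\<beta> = 7s/8\<close>, and the Laplace parameter \<open>3\<close> nearly maximise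
  the margin \<open>ln (1 + 2 \<mu> 6/7) - \<beta>/s - 2 \<mu> t/\<beta>\<close> in the extremal case \<open>8 t = s\<close>. The parameter
  \<open>1/40\<close> of the trace bound only has to make \<open>- ln (19/20) / (1/20)\<close> close to \<open>1\<close>.\<close>
lemma small_kernel_event:
  fixes q :: "'d \<Rightarrow> real^'d"
  assumes q: "orthonormal_family q" and h: "\<And>i. 0 \<le> h i" and \<gamma>: "0 < \<gamma>" and \<delta>: "0 < \<delta>" "\<delta> < 1"
  defines "t \<equiv> (\<Sum>i\<in>UNIV. h i / (h i + \<gamma>))"
  assumes s_large: "8 * (sqrt t + sqrt (8 * ln (16 / \<delta>)))\<^sup>2 \<le> real CARD('s)"
  shows "\<exists>A\<in>events. 1 - \<delta> \<le> prob A \<and> (\<forall>\<omega>\<in>A. \<forall>z.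
    transpose (\<Omega> \<omega>) *v (spectral_matrix q (\<lambda>i. sqrt (h i)) *v z) = 0 \<longrightarrow>
    z \<bullet> (spectral_matrix q h *v z) \<le> 6 * \<gamma> * (z \<bullet> z))"
proof -
  define s where "s = real CARD('s)"
  define d where "d i = h i / (h i + \<gamma>)" for i
  have hg: "0 < h i + \<gamma>" for i using h[of i] \<gamma> by linarith
  have d: "0 \<le> d i" "d i \<le> 1" for i using h[of i] hg[of i] \<gamma> by (auto simp: d_def)
  have t: "t = sum d UNIV" "0 \<le> t" using d(1) by (auto simp: t_def d_def intro!: sum_nonneg)
  have qq: "q i \<bullet> q i = 1" for i using q by (simp add: orthonormal_family_def)
  define l where "l = ln (2 / \<delta>)"
  have l: "0 \<le> l" "l \<le> ln (16 / \<delta>)" using \<delta> by (auto simp: l_def field_simps intro!: ln_mono)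
  \<comment> \<open>Only used to force \<open>100 \<le> s\<close>, since 64 times 8/3 exceeds
    100.\<close>
  have ln16: "8 / 3 \<le> ln (16 / \<delta>)"
  proof -
    have "8 / 3 \<le> 4 * ln (2 :: real)" using ln2_ge_two_thirds by simp
    also have "\<dots> = ln (16 :: real)" using ln_realpow[of 2 4] by simp
    also have "\<dots> \<le> ln (16 / \<delta>)" using \<delta> by (intro ln_mono) (auto simp: field_simps)
    finally show ?thesis .
  qed
  have root: "sqrt (8 * t) + sqrt (64 * ln (16 / \<delta>)) \<le> sqrt s"
  proof (rule real_le_rsqrt)
    have "sqrt (64 * ln (16 / \<delta>)) = sqrt 8 * sqrt (8 * ln (16 / \<delta>))" by (simp add: real_sqrt_mult[symmetric])
    then have "sqrt (8 * t) + sqrt (64 * ln (16 / \<delta>)) = sqrt 8 * (sqrt t + sqrt (8 * ln (16 / \<delta>)))"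
      by (simp add: real_sqrt_mult distrib_left)
    then show "(sqrt (8 * t) + sqrt (64 * ln (16 / \<delta>)))\<^sup>2 \<le> s"
      using s_large by (simp add: power_mult_distrib s_def)
  qed
  have s100: "100 \<le> s"
  proof -
    have "sqrt (64 * ln (16 / \<delta>)) \<le> sqrt s" using root t(2) real_sqrt_ge_zero[of "8 * t"] by linarith
    then show ?thesis using ln16 by simp
  qed
  have "sqrt (8 * t) + sqrt (64 * l) \<le> sqrt s"
    using root real_sqrt_le_mono[of "64 * l" "64 * ln (16 / \<delta>)"] l(2) by linarith
  note margin = sketch_size_margin[OF s100 t(2) l(1) this]
  define \<beta> where "\<beta> = 7 * s / 8"
  have \<beta>: "0 < \<beta>" using s100 by (simp add: \<beta>_def)
  \<comment> \<open>The square root of \<open>D / \<beta>\<close>, in the eigenbasis of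
    \<open>H\<close>.\<close>
  define B where "B = spectral_matrix q (\<lambda>i. sqrt (d i / \<beta>))"
  have Bt: "transpose B = B" by (simp add: B_def transpose_spectral_matrix)
  define N where "N \<omega> i = (transpose (\<Omega> \<omega>) *v q i) \<bullet> (transpose (\<Omega> \<omega>) *v q i)" for \<omega> i
  define J where "J \<omega> = (\<Sum>i\<in>UNIV. d i / t * exp (1 / 40 * N \<omega> i))" for \<omega>
  \<comment> \<open>The moment bound at parameter 1/40, where
    \<open>1 - 2 / 40 = 19 / 20\<close>.\<close>
  define C where "C = (19 / 20 :: real) powr (- s / 2)"
  have C: "0 < C" by (simp add: C_def)
  have [measurable]: "(\<lambda>\<omega>. N \<omega> i) \<in> borel_measurable M" for i
    unfolding N_def transpose_mult_inner_self by measurable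
  have [measurable]: "J \<in> borel_measurable M" unfolding J_def[abs_def] by measurable
  have [measurable]: "smoothed 3 B \<in> borel_measurable M" by (rule measurable_smoothed)
  have "(\<integral>\<^sup>+\<omega>. ennreal (J \<omega>) \<partial>M) \<le> ennreal C"
    using trace_exp_moment_le[of q "\<lambda>i. d i / t" "1 / 40"] qq d(1) t
    by (simp add: J_def N_def C_def s_def sum_divide_distrib[symmetric])
  then have P2: "prob {\<omega> \<in> space M. ennreal (C * (2 / \<delta>)) \<le> ennreal (J \<omega>)} \<le> \<delta> / 2"
    using C \<delta> by (intro markov_event) auto
  have P1: "prob {\<omega> \<in> space M. ennreal (1 * (2 / \<delta>)) \<le> smoothed 3 B \<omega>} \<le> \<delta> / 2"
    using \<delta> nn_integral_smoothed[of 3 B] by (intro markov_event) auto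
  define E1 where "E1 = {\<omega> \<in> space M. ennreal (1 * (2 / \<delta>)) \<le> smoothed 3 B \<omega>}"
  define E2 where "E2 = {\<omega> \<in> space M. ennreal (C * (2 / \<delta>)) \<le> ennreal (J \<omega>)}"
  have E[measurable]: "E1 \<in> events" "E2 \<in> events" unfolding E1_def E2_def by measurable
  define A where "A = space M - (E1 \<union> E2)"
  have A: "A \<in> events" unfolding A_def by measurable
  have "prob (E1 \<union> E2) \<le> \<delta>"
    using measure_Un_le[OF E] P1 P2 unfolding E1_def[symmetric] E2_def[symmetric] by simp
  then have prA: "1 - \<delta> \<le> prob A" unfolding A_def by (subst prob_compl) auto
  have bad: "z \<bullet> (spectral_matrix q h *v z) \<le> 6 * \<gamma> * (z \<bullet> z)"
    if \<omega>: "\<omega> \<in> A" and ker: "transpose (\<Omega> \<omega>) *v (spectral_matrix q (\<lambda>i. sqrt (h i)) *v z) = 0" for \<omega> z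
  proof (rule ccontr)
    assume "\<not> ?thesis"
    then have big: "6 * \<gamma> * (z \<bullet> z) < z \<bullet> (spectral_matrix q h *v z)" by simp
    define e where "e = z \<bullet> (spectral_matrix q h *v z)"
    define r where "r = e + \<gamma> * (z \<bullet> z)"
    have e: "0 < e" using big \<gamma> by (smt (verit) e_def inner_ge_zero mult_nonneg_nonneg)
    have r: "0 < r" using e \<gamma> by (simp add: r_def add_pos_nonneg)
    \<comment> \<open>A Rayleigh quotient above \<open>6 * \<gamma>\<close> leaves more than six
      sevenths of \<open>r\<close> to the \<open>H\<close> part.\<close>
    have er: "6 / 7 < e / r" using big r by (simp add: r_def e_def field_simps)
    \<comment> \<open>Chosen so that \<open>B *v x\<close> is the kernel vector scaled by
      \<open>1 / sqrt r\<close>, while \<open>x \<bullet> x\<close> is exactly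
      \<open>\<beta>\<close>.\<close>
    define x where "x = sqrt (\<beta> / r) *\<^sub>R (spectral_matrix q (\<lambda>i. sqrt (h i + \<gamma>)) *v z)"
    define v where "v = B *v x"
    have xx: "x \<bullet> x = \<beta>"
    proof -
      let ?S = "spectral_matrix q (\<lambda>i. sqrt (h i + \<gamma>))"
      have "?S ** ?S = spectral_matrix q h + \<gamma> *\<^sub>R mat 1"
        using hg by (simp add: spectral_matrix_mult[OF q] spectral_matrix_shift[OF q] less_imp_le)
      then have "(?S *v z) \<bullet> (?S *v z) = z \<bullet> ((spectral_matrix q h + \<gamma> *\<^sub>R mat 1) *v z)"
        using symmetric_matrix_inner[OF transpose_spectral_matrix, of z q "\<lambda>i. sqrt (h i + \<gamma>)" "?S *v z"]
        by (simp add: matrix_vector_mul_assoc)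
      also have "\<dots> = r"
        by (simp add: r_def e_def matrix_vector_mult_add_rdistrib scaleR_matrix_vector_assoc[symmetric] inner_add_right)
      finally have "x \<bullet> x = (sqrt (\<beta> / r) * sqrt (\<beta> / r)) * r"
        by (simp only: x_def inner_scaleR_left inner_scaleR_right mult.assoc)
      then show ?thesis using \<beta> r by (subst (asm) real_sqrt_mult_self) simp
    qed
    have v: "v = (1 / sqrt r) *\<^sub>R (spectral_matrix q (\<lambda>i. sqrt (h i)) *v z)"
    proof -
      have eq: "sqrt (\<beta> / r) * (sqrt (d i / \<beta>) * sqrt (h i + \<gamma>)) = 1 / sqrt r * sqrt (h i)" for i
        using \<beta> hg[of i] by (simp add: d_def real_sqrt_divide real_sqrt_mult)
      have "v = sqrt (\<beta> / r) *\<^sub>R (spectral_matrix q (\<lambda>i. sqrt (d i / \<beta>) * sqrt (h i + \<gamma>)) *v z)"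
        by (simp only: v_def x_def B_def matrix_vector_mult_scaleR matrix_vector_mul_assoc spectral_matrix_mult[OF q])
      then show ?thesis
        by (simp only: scaleR_matrix_vector_assoc spectral_matrix_scaleR eq)
    qed
    have vv: "v \<bullet> v = e / r"
    proof -
      let ?R = "spectral_matrix q (\<lambda>i. sqrt (h i))"
      have "(?R *v z) \<bullet> (?R *v z) = e"
        using symmetric_matrix_inner[OF transpose_spectral_matrix, of z q "\<lambda>i. sqrt (h i)" "?R *v z"] h
        by (simp add: matrix_vector_mul_assoc spectral_matrix_mult[OF q] e_def)
      then show ?thesis using r by (simp add: v)
    qed
    have kerv: "transpose (\<Omega> \<omega>) *v (B *v x) = 0"
      unfolding v_def[symmetric] v by (simp add: matrix_vector_mult_scaleR ker)
    have v0: "B *v x \<noteq> 0" using vv er by (auto simp: v_def)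
    have BB: "(B *v v) \<bullet> (B *v v) / (v \<bullet> v) \<le> 1 / \<beta>"
    proof -
      have "norm (B *v v) \<le> sqrt (1 / \<beta>) * norm v"
        unfolding B_def using d \<beta>
        by (intro norm_spectral_matrix_le[OF q]) (auto simp: divide_right_mono)
      then have "(norm (B *v v))\<^sup>2 \<le> (sqrt (1 / \<beta>) * norm v)\<^sup>2" by (rule power_mono) simp
      then have "(B *v v) \<bullet> (B *v v) \<le> 1 / \<beta> * (v \<bullet> v)"
        using \<beta> by (simp add: power2_norm_eq_inner power_mult_distrib power_divide)
      moreover have "0 < v \<bullet> v" using v0 by (simp add: v_def)
      ultimately show ?thesis by (simp add: divide_le_eq)
    qed
    \<comment> \<open>The trace of \<open>D\<close> compressed by \<open>\<Omega>\<close>, written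
      in the eigenbasis.\<close>
    define T where "T = (\<Sum>i\<in>UNIV. d i * N \<omega> i)"
    have T: "(\<Sum>j\<in>UNIV. (B *v column j (\<Omega> \<omega>)) \<bullet> (B *v column j (\<Omega> \<omega>))) = T / \<beta>"
    proof -
      have "(B *v c) \<bullet> (B *v c) = (\<Sum>i\<in>UNIV. d i / \<beta> * (q i \<bullet> c)\<^sup>2)" for c
      proof -
        have "(B *v c) \<bullet> (B *v c) = c \<bullet> (B *v (B *v c))" by (rule symmetric_matrix_inner[OF Bt, symmetric])
        also have "\<dots> = c \<bullet> (spectral_matrix q (\<lambda>i. d i / \<beta>) *v c)"
          using d(1) \<beta> by (simp add: B_def matrix_vector_mul_assoc spectral_matrix_mult[OF q] del: real_sqrt_divide)
        finally show ?thesis by (simp add: quadratic_spectral_matrix power2_eq_square mult.assoc)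
      qed
      then have "(\<Sum>j\<in>UNIV. (B *v column j (\<Omega> \<omega>)) \<bullet> (B *v column j (\<Omega> \<omega>)))
          = (\<Sum>i\<in>UNIV. \<Sum>j\<in>UNIV. d i / \<beta> * (q i \<bullet> column j (\<Omega> \<omega>))\<^sup>2)"
        by (simp only:) (rule sum.swap)
      also have "\<dots> = (\<Sum>i\<in>UNIV. d i / \<beta> * N \<omega> i)"
        unfolding N_def transpose_mult_inner_self by (simp add: inner_vec_def column_def sum_distrib_left)
      finally show ?thesis by (simp add: T_def sum_divide_distrib)
    qed
    have T_le: "T \<le> 40 * t * l + 20 / 19 * s * t"
    proof (cases "t = 0")
      case True
      then have "d i = 0" for i using d(1) t(1) by (simp add: sum_nonneg_eq_0_iff)
      then show ?thesis using True by (simp add: T_def)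
    next
      case False
      then have t0: "0 < t" using t(2) by simp
      \<comment> \<open>Finite Jensen with weights \<open>d i / t\<close> compares the exponential
        of the trace with \<open>J\<close>, which is below its Markov threshold on
        \<open>A\<close>.\<close>
      have "exp (T / (40 * t)) = exp (\<Sum>i\<in>UNIV. d i / t * (1 / 40 * N \<omega> i))"
        by (simp add: T_def sum_divide_distrib mult_ac)
      also have "\<dots> \<le> J \<omega>"
        unfolding J_def using d(1) t0 t(1)
        by (intro exp_weighted_sum_le) (auto simp: sum_divide_distrib[symmetric])
      also have "J \<omega> < C * (2 / \<delta>)"
      proof (rule ccontr)
        assume "\<not> J \<omega> < C * (2 / \<delta>)"
        then have "ennreal (C * (2 / \<delta>)) \<le> ennreal (J \<omega>)" by (intro ennreal_leI) simp
        then show False using \<omega> unfolding A_def E2_def by blast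
      qed
      finally have "exp (T / (40 * t)) < C * (2 / \<delta>)" .
      from ln_strict_mono[OF this exp_gt_zero] have "T / (40 * t) < ln (C * (2 / \<delta>))"
        by (simp only: ln_exp)
      also have "\<dots> = - s / 2 * ln (19 / 20) + l"
      proof -
        have "ln (C * (2 / \<delta>)) = ln C + ln (2 / \<delta>)" using C \<delta> by (intro ln_mult_pos) auto
        moreover have "ln C = - s / 2 * ln (19 / 20)" by (simp add: C_def ln_powr)
        ultimately show ?thesis by (simp only: l_def)
      qed
      also have "\<dots> \<le> s / 2 * (1 / 19) + l"
      proof -
        have "- ln (19 / 20) = ln (20 / 19 :: real)" using ln_div[of 20 19] ln_div[of 19 20] by simp
        also have "\<dots> \<le> 1 / 19" using ln_le_minus_one[of "20 / 19"] by simp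
        finally have "s / 2 * (- ln (19 / 20)) \<le> s / 2 * (1 / 19)" using s100 by (intro mult_left_mono) auto
        then show ?thesis by simp
      qed
      finally show ?thesis using t0 by (simp add: field_simps)
    qed
    have lnv: "179 / 100 \<le> ln (1 + 2 * 3 * (v \<bullet> v))"
    proof -
      have "exp (179 / 100) \<le> 1 + 2 * 3 * (v \<bullet> v)"
        using exp_179_100_le er unfolding vv by linarith
      then show ?thesis using ln_ge_iff less_le_trans[OF exp_gt_zero] by blast
    qed
    have "ennreal (exp (- (x \<bullet> x) / 2
      + s / 2 * (ln (1 + 2 * 3 * (v \<bullet> v)) - 3 / 4 * ((B *v v) \<bullet> (B *v v) / (v \<bullet> v)))
      - 3 * (T / \<beta>))) \<le> smoothed 3 B \<omega>"
      using smoothed_ge[OF Bt _ kerv v0, of 3] unfolding v_def[symmetric] s_def[symmetric] T by simp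
    also have "\<dots> < ennreal (2 / \<delta>)"
      using \<omega> by (auto simp: A_def E1_def not_le)
    finally have "exp (- (x \<bullet> x) / 2
      + s / 2 * (ln (1 + 2 * 3 * (v \<bullet> v)) - 3 / 4 * ((B *v v) \<bullet> (B *v v) / (v \<bullet> v)))
      - 3 * (T / \<beta>)) < 2 / \<delta>"
      by (simp add: ennreal_less_iff)
    from ln_strict_mono[OF this exp_gt_zero] have up: "- (x \<bullet> x) / 2
      + s / 2 * (ln (1 + 2 * 3 * (v \<bullet> v)) - 3 / 4 * ((B *v v) \<bullet> (B *v v) / (v \<bullet> v)))
      - 3 * (T / \<beta>) < l"
      unfolding l_def by (simp only: ln_exp)
    \<comment> \<open>Worst-case values are inserted for every term; substituting
      \<open>\<beta> = 7 * s / 8\<close> then produces the expression in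
      \<open>margin\<close>.\<close>
    have "- \<beta> / 2 + s / 2 * (179 / 100 - 3 / 4 * (1 / \<beta>)) - 3 * ((40 * t * l + 20 / 19 * s * t) / \<beta>)
      \<le> - (x \<bullet> x) / 2
      + s / 2 * (ln (1 + 2 * 3 * (v \<bullet> v)) - 3 / 4 * ((B *v v) \<bullet> (B *v v) / (v \<bullet> v)))
      - 3 * (T / \<beta>)"
      unfolding xx using lnv BB T_le \<beta> s100
      by (intro diff_mono add_mono mult_left_mono divide_right_mono order_refl) auto
    also note up
    also have "- \<beta> / 2 + s / 2 * (179 / 100 - 3 / 4 * (1 / \<beta>)) - 3 * ((40 * t * l + 20 / 19 * s * t) / \<beta>)
      = - 7 * s / 16 + s / 2 * (179 / 100) - 3 / 7 - 24 / 7 * (40 * t * l / s + 20 / 19 * t)"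
      using s100 by (simp add: \<beta>_def field_simps)
    finally show False using margin by simp
  qed
  show ?thesis using A prA bad by blast
qed

end

section \<open>Combination of the effective dimension bound, the kernel event and the condition
  number estimate\<close>

theorem theorem4p4:
  fixes H :: "real^'d^'d"
    and \<rho> \<delta> \<epsilon> :: real
    and M :: "'w measure"
    and \<Omega> :: "'w \<Rightarrow> real^'s^'d"
  assumes psd: "sym_psd H"
    and rho: "\<rho> > 0"
    and delta: "0 < \<delta>" "\<delta> < 1"
    and eps: "\<epsilon> > 0"
    and prob: "prob_space M"
    and gauss_indep: "prob_space.indep_vars M (\<lambda>_. borel) (\<lambda>(i, j) \<omega>. \<Omega> \<omega> $ i $ j) UNIV"
    and gauss_std: "\<And>i j. distributed M lborel (\<lambda>\<omega>. \<Omega> \<omega> $ i $ j) std_normal_density"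
    and s_large: "real CARD('s) \<ge>
        8 * (sqrt (d_eff H (\<epsilon> * \<rho> / 6)) + sqrt (8 * ln (16 / \<delta>)))\<^sup>2"
  shows "(\<forall>\<omega>\<in>space M. \<forall>U \<Lambda>. nystrom_eig H (\<Omega> \<omega>) U \<Lambda> \<longrightarrow>
             (lam_s \<Lambda> + \<rho>) / \<rho> \<le> 1 + \<epsilon> / 42)
       \<and> (\<exists>A\<in>prob_space.events M. prob_space.prob M A \<ge> 1 - \<delta> \<and>
             (\<forall>\<omega>\<in>A. \<forall>U \<Lambda>. nystrom_eig H (\<Omega> \<omega>) U \<Lambda> \<longrightarrow>
               (let P = nys_precond U \<Lambda> \<rho>; H\<^sub>\<rho> = H + \<rho> *\<^sub>R mat 1 in
                 \<bar>cond2 (inv_sqrt P ** H\<^sub>\<rho> ** inv_sqrt P) - (lam_s \<Lambda> + \<rho>) / \<rho>\<bar> \<le> \<epsilon>)))"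
proof -
  interpret gaussian_matrix M \<Omega>
    using prob gauss_indep gauss_std by (intro gaussian_matrix.intro gaussian_matrix_axioms.intro)
  define \<gamma> where "\<gamma> = \<epsilon> * \<rho> / 6"
  have \<gamma>: "0 < \<gamma>" using eps rho by (simp add: \<gamma>_def)
  obtain q h where q: "orthonormal_family q" and H: "H = spectral_matrix q h" and h: "\<And>i. 0 \<le> h i"
    using sym_psd_spectral[OF psd] by metis
  have deff: "d_eff H \<gamma> = (\<Sum>i\<in>UNIV. h i / (h i + \<gamma>))"
    unfolding H by (rule d_eff_spectral_matrix[OF q h \<gamma>])
  have d0: "0 \<le> d_eff H \<gamma>"
    unfolding deff using h \<gamma> by (intro sum_nonneg divide_nonneg_nonneg add_nonneg_nonneg) auto
  have large: "8 * (sqrt (d_eff H \<gamma>) + sqrt (8 * ln (16 / \<delta>)))\<^sup>2 \<le> real CARD('s)"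
    using s_large by (simp add: \<gamma>_def)
  have "8 * d_eff H \<gamma> \<le> 8 * (sqrt (d_eff H \<gamma>) + sqrt (8 * ln (16 / \<delta>)))\<^sup>2"
  proof -
    have "0 \<le> ln (16 / \<delta>)" using delta by (simp add: field_simps)
    then have "(sqrt (d_eff H \<gamma>))\<^sup>2 \<le> (sqrt (d_eff H \<gamma>) + sqrt (8 * ln (16 / \<delta>)))\<^sup>2"
      using d0 by (intro power_mono) auto
    then show ?thesis using d0 by simp
  qed
  with large have eight: "8 * d_eff H \<gamma> \<le> real CARD('s)" by linarith
  \<comment> \<open>Deterministic: it holds for every sketch matrix, not only on the good
    event.\<close>
  have emp: "(lam_s \<Lambda> + \<rho>) / \<rho> \<le> 1 + \<epsilon> / 42" if "nystrom_eig H \<Omega>' U \<Lambda>" for \<Omega>' :: "real^'s^'d" and U \<Lambda>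
    using lam_s_le_of_d_eff[OF psd \<gamma> that eight] rho by (simp add: \<gamma>_def field_simps)
  define R where "R = spectral_matrix q (\<lambda>i. sqrt (h i))"
  have R: "transpose R = R" "R ** R = H"
    using h by (simp_all add: R_def transpose_spectral_matrix spectral_matrix_mult[OF q] H)
  obtain A where A: "A \<in> events" "1 - \<delta> \<le> prob A"
    and ker: "\<And>\<omega> z. \<omega> \<in> A \<Longrightarrow> transpose (\<Omega> \<omega>) *v (R *v z) = 0 \<Longrightarrow> z \<bullet> (H *v z) \<le> 6 * \<gamma> * (z \<bullet> z)"
    using small_kernel_event[OF q h \<gamma> delta large[unfolded deff]] unfolding R_def H by blast
  have "\<bar>cond2 (inv_sqrt (nys_precond U \<Lambda> \<rho>) ** (H + \<rho> *\<^sub>R mat 1) ** inv_sqrt (nys_precond U \<Lambda> \<rho>))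
      - (lam_s \<Lambda> + \<rho>) / \<rho>\<bar> \<le> \<epsilon>" (is "\<bar>?\<kappa> - _\<bar> \<le> _")
    if \<omega>: "\<omega> \<in> A" and ne: "nystrom_eig H (\<Omega> \<omega>) U \<Lambda>" for \<omega> U \<Lambda>
  proof -
    have err: "x \<bullet> (H *v x) \<le> x \<bullet> (nystrom H (\<Omega> \<omega>) *v x) + 6 * \<gamma> * (x \<bullet> x)" for x
      using \<gamma> by (intro nystrom_error_le[OF R]) (auto intro: ker[OF \<omega>])
    have "1 \<le> ?\<kappa>" "?\<kappa> \<le> (lam_s \<Lambda> + \<rho> + 6 * \<gamma>) / \<rho>"
      using cond2_preconditioned_bounds[OF psd rho ne _ err] \<gamma> by auto
    moreover have "(lam_s \<Lambda> + \<rho> + 6 * \<gamma>) / \<rho> = (lam_s \<Lambda> + \<rho>) / \<rho> + \<epsilon>"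
      using rho by (simp add: \<gamma>_def field_simps)
    \<comment> \<open>Above, the error \<open>6 * \<gamma>\<close> contributes exactly
      \<open>\<epsilon>\<close>. Below, \<open>emp\<close> puts the empirical condition number
      within \<open>\<epsilon> / 42\<close> of 1, and \<open>?\<kappa>\<close> is at least
      1.\<close>
    ultimately show ?thesis using emp[OF ne] eps unfolding abs_le_iff by linarith
  qed
  with A emp show ?thesis unfolding Let_def by blast
qed

end
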